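(* Let $a<b$, $\alpha\in(0,1)$, $\beta>0$, and let $L:(x,y,v,w,z)\mapsto L(x,y,v,w,z)$ and $l:(x,y,v,w)\mapsto l(x,y,v,w)$ be real-valued functions of class $C^1$. For $y\in\mathcal{F}([a,b];\mathbb{R})$ put $$z(x)=\int_a^x l\bigl(t,y(t),{^C_aD_t^\alpha}y(t),{_aI_t^\beta}y(t)\bigr)\,dt,$$ $\{y\}(x)=(x,y(x),{^C_aD_x^\alpha}y(x),{_aI_x^\beta}y(x))$, $[y](x)=(x,y(x),{^C_aD_x^\alpha}y(x),{_aI_x^\beta}y(x),z(x))$, and for $T\in[a,b]$ $$J(y,T)=\int_a^T L[y](x)\,dx.$$ Let $(y,T)\in\mathcal{F}([a,b];\mathbb{R})\times[a,b]$ be a minimizer of $J$ (no boundary conditions are imposed on $y$). Then, for all $x\in[a,T]$, $(y,T)$ satisfies the fractional equation $$\frac{\partial L}{\partial y}[y](x)+{_xD^\alpha_T}\left(\frac{\partial L}{\partial v}[y](x)\right)+{_xI_T^\beta}\left(\frac{\partial L}{\partial w}[y](x)\right)+\int_x^T\frac{\partial L}{\partial z}[y](t)\,dt\cdot\frac{\partial l}{\partial y}\{y\}(x)$$ $$+{_xD^\alpha_T}\left(\int_x^T\frac{\partial L}{\partial z}[y](t)\,dt\cdot\frac{\partial l}{\partial v}\{y\}(x)\right)+{_xI^\beta_T}\left(\int_x^T\frac{\partial L}{\partial z}[y](t)\,dt\cdot\frac{\partial l}{\partial w}\{y\}(x)\right)=0$$ and the transversality conditions $$\left[{_xI_T^{1-\alpha}}\left(\frac{\partial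 L}{\partial v}[y](x)+\int_x^T\frac{\partial L}{\partial z}[y](t)\,dt\cdot\frac{\partial l}{\partial v}\{y\}(x)\right)\right]_{x=a}=0\quad\text{and}\quad L[y](T)=0.$$
   Context: For $\gamma>0$, the left Riemann--Liouville fractional integral is ${_aI_x^\gamma}f(x)=\frac{1}{\Gamma(\gamma)}\int_a^x(x-t)^{\gamma-1}f(t)\,dt$ and the right one with terminal point $T$ is ${_xI_T^\gamma}f(x)=\frac{1}{\Gamma(\gamma)}\int_x^T(t-x)^{\gamma-1}f(t)\,dt$. For $\alpha\in(0,1)$, the right Riemann--Liouville fractional derivative with terminal point $T$ is ${_xD_T^\alpha}f(x)=\frac{-1}{\Gamma(1-\alpha)}\frac{d}{dx}\int_x^T(t-x)^{-\alpha}f(t)\,dt$, and the left Caputo fractional derivative of an absolutely continuous $f$ is ${^C_aD_x^\alpha}f(x)=\frac{1}{\Gamma(1-\alpha)}\int_a^x(x-t)^{-\alpha}f'(t)\,dt$. $\mathcal{F}([a,b];\mathbb{R})$ denotes the class of absolutely continuous functions $y:[a,b]\to\mathbb{R}$ such that ${^C_aD_x^\alpha}y(x)$ and ${_aI_x^\beta}y(x)$ exist and are continuous on $[a,b]$. Partial derivatives of $L$ are with respect to its named variables and are evaluated at $[y](\cdot)$; those of $l$ are evaluated at $\{y\}(\cdot)$. An expression such as ${_xD_T^\alpha}(\phi(x))$ means the operator applied to the function $\phi$, evaluated at $x$.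
   Formalization: L[y](T)=0 is claimed only for a<T<b (false at the ends: L=±1) and the fractional equation only for a<T (false at T=a: L=2+sin y); the two D-terms stand separately only where both exist, but the equation with D of their sum is proved for all x in [a,T]. *)

theory Defs
  imports "HOL-Analysis.Analysis"
begin

text \<open>
  Functions on \<open>[a,b]\<close> are total functions \<open>real \<Rightarrow> real\<close>; only their values on \<open>[a,b]\<close> matter
  below. Integrals are Lebesgue integrals.
\<close>

definition rl_int_left :: "real \<Rightarrow> real \<Rightarrow> (real \<Rightarrow> real) \<Rightarrow> real \<Rightarrow> real" where
  "rl_int_left a \<gamma> f x =
     1 / Gamma \<gamma> * (LINT t:{a..x}|lebesgue. (x - t) powr (\<gamma> - 1) * f t)"

definition rl_int_left_exists :: "real \<Rightarrow> real \<Rightarrow> (real \<Rightarrow> real) \<Rightarrow> real \<Rightarrow> bool" where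
  "rl_int_left_exists a \<gamma> f x \<longleftrightarrow>
     set_integrable lebesgue {a..x} (\<lambda>t. (x - t) powr (\<gamma> - 1) * f t)"

definition rl_int_right :: "real \<Rightarrow> real \<Rightarrow> (real \<Rightarrow> real) \<Rightarrow> real \<Rightarrow> real" where
  "rl_int_right T \<gamma> f x =
     1 / Gamma \<gamma> * (LINT t:{x..T}|lebesgue. (t - x) powr (\<gamma> - 1) * f t)"

text \<open>
  The function to be differentiated is considered on \<open>[a,T]\<close> only, so that \<open>d/dx\<close> is one-sided
  at \<open>a\<close> and at \<open>T\<close>. The value of \<open>rl_deriv_right\<close> is meaningful only where
  \<open>rl_deriv_right_exists\<close> holds (and \<open>a < T\<close>).
\<close>

definition rl_deriv_right :: "real \<Rightarrow> real \<Rightarrow> real \<Rightarrow> (real \<Rightarrow> real) \<Rightarrow> real \<Rightarrow> real" where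
  "rl_deriv_right a T \<alpha> f x =
     - 1 / Gamma (1 - \<alpha>) *
       vector_derivative (\<lambda>s. LINT t:{s..T}|lebesgue. (t - s) powr (- \<alpha>) * f t)
         (at x within {a..T})"

definition rl_deriv_right_exists :: "real \<Rightarrow> real \<Rightarrow> real \<Rightarrow> (real \<Rightarrow> real) \<Rightarrow> real \<Rightarrow> bool" where
  "rl_deriv_right_exists a T \<alpha> f x \<longleftrightarrow>
     (\<lambda>s. LINT t:{s..T}|lebesgue. (t - s) powr (- \<alpha>) * f t)
       differentiable (at x within {a..T})"

text \<open>
  In the Caputo derivative, \<open>deriv f\<close> is the derivative at the points where it exists, which for an
  absolutely continuous \<open>f\<close> is almost everywhere; the value of \<open>deriv f\<close> on the exceptional null
  set does not influence the integral or its existence.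
\<close>

definition caputo_left :: "real \<Rightarrow> real \<Rightarrow> (real \<Rightarrow> real) \<Rightarrow> real \<Rightarrow> real" where
  "caputo_left a \<alpha> f x =
     1 / Gamma (1 - \<alpha>) * (LINT t:{a..x}|lebesgue. (x - t) powr (- \<alpha>) * deriv f t)"

definition caputo_left_exists :: "real \<Rightarrow> real \<Rightarrow> (real \<Rightarrow> real) \<Rightarrow> real \<Rightarrow> bool" where
  "caputo_left_exists a \<alpha> f x \<longleftrightarrow>
     set_integrable lebesgue {a..x} (\<lambda>t. (x - t) powr (- \<alpha>) * deriv f t)"

text \<open>
  The usual epsilon-delta definition; a finite family of non-overlapping compact subintervals
  of \<open>S\<close> is a division of its union.
\<close>

definition absolutely_continuous_fun_on :: "real set \<Rightarrow> (real \<Rightarrow> real) \<Rightarrow> bool" where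
  "absolutely_continuous_fun_on S f \<longleftrightarrow>
     (\<forall>\<epsilon>>0. \<exists>\<delta>>0. \<forall>d. d division_of (\<Union>d) \<and> \<Union>d \<subseteq> S \<and> (\<Sum>k\<in>d. Sup k - Inf k) < \<delta> \<longrightarrow>
        (\<Sum>k\<in>d. \<bar>f (Sup k) - f (Inf k)\<bar>) < \<epsilon>)"

definition frac_class :: "real \<Rightarrow> real \<Rightarrow> real \<Rightarrow> real \<Rightarrow> (real \<Rightarrow> real) set" where
  "frac_class a b \<alpha> \<beta> = {y.
     absolutely_continuous_fun_on {a..b} y \<and>
     (\<forall>x\<in>{a..b}. caputo_left_exists a \<alpha> y x) \<and> continuous_on {a..b} (caputo_left a \<alpha> y) \<and>
     (\<forall>x\<in>{a..b}. rl_int_left_exists a \<beta> y x) \<and> continuous_on {a..b} (rl_int_left a \<beta> y)}"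

definition C1_on :: "'a::real_normed_vector set \<Rightarrow> ('a \<Rightarrow> real) \<Rightarrow> bool" where
  "C1_on S f \<longleftrightarrow> (\<exists>f'. continuous_on S f' \<and>
     (\<forall>p\<in>S. (f has_derivative blinfun_apply (f' p)) (at p within S)))"

type_synonym fun4 = "real \<times> real \<times> real \<times> real \<Rightarrow> real"
type_synonym fun5 = "real \<times> real \<times> real \<times> real \<times> real \<Rightarrow> real"

definition l_dy :: "fun4 \<Rightarrow> fun4" where
  "l_dy l = (\<lambda>(x, y, v, w). deriv (\<lambda>s. l (x, s, v, w)) y)"

definition l_dv :: "fun4 \<Rightarrow> fun4" where
  "l_dv l = (\<lambda>(x, y, v, w). deriv (\<lambda>s. l (x, y, s, w)) v)"

definition l_dw :: "fun4 \<Rightarrow> fun4" where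
  "l_dw l = (\<lambda>(x, y, v, w). deriv (\<lambda>s. l (x, y, v, s)) w)"

definition L_dy :: "fun5 \<Rightarrow> fun5" where
  "L_dy L = (\<lambda>(x, y, v, w, z). deriv (\<lambda>s. L (x, s, v, w, z)) y)"

definition L_dv :: "fun5 \<Rightarrow> fun5" where
  "L_dv L = (\<lambda>(x, y, v, w, z). deriv (\<lambda>s. L (x, y, s, w, z)) v)"

definition L_dw :: "fun5 \<Rightarrow> fun5" where
  "L_dw L = (\<lambda>(x, y, v, w, z). deriv (\<lambda>s. L (x, y, v, s, z)) w)"

definition L_dz :: "fun5 \<Rightarrow> fun5" where
  "L_dz L = (\<lambda>(x, y, v, w, z). deriv (\<lambda>s. L (x, y, v, w, s)) z)"

text \<open>\<open>braces\<close> is \<open>{y}\<close>, \<open>z_int\<close> is \<open>z\<close>, and \<open>brackets\<close> is \<open>[y]\<close>.\<close>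

definition braces :: "real \<Rightarrow> real \<Rightarrow> real \<Rightarrow> (real \<Rightarrow> real) \<Rightarrow> real \<Rightarrow> real \<times> real \<times> real \<times> real" where
  "braces a \<alpha> \<beta> y x = (x, y x, caputo_left a \<alpha> y x, rl_int_left a \<beta> y x)"

definition z_int :: "real \<Rightarrow> real \<Rightarrow> real \<Rightarrow> fun4 \<Rightarrow> (real \<Rightarrow> real) \<Rightarrow> real \<Rightarrow> real" where
  "z_int a \<alpha> \<beta> l y x = (LINT t:{a..x}|lebesgue. l (braces a \<alpha> \<beta> y t))"

definition brackets ::
  "real \<Rightarrow> real \<Rightarrow> real \<Rightarrow> fun4 \<Rightarrow> (real \<Rightarrow> real) \<Rightarrow> real \<Rightarrow> real \<times> real \<times> real \<times> real \<times> real" where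
  "brackets a \<alpha> \<beta> l y x =
     (x, y x, caputo_left a \<alpha> y x, rl_int_left a \<beta> y x, z_int a \<alpha> \<beta> l y x)"

definition J_fun :: "real \<Rightarrow> real \<Rightarrow> real \<Rightarrow> fun5 \<Rightarrow> fun4 \<Rightarrow> (real \<Rightarrow> real) \<Rightarrow> real \<Rightarrow> real" where
  "J_fun a \<alpha> \<beta> L l y T = (LINT x:{a..T}|lebesgue. L (brackets a \<alpha> \<beta> l y x))"

end

(* Let (y, T) be a minimizer. Perturbing y by a multiple of a C1 function eta changes the Caputo
   derivative and the fractional integral linearly: an absolutely continuous y is differentiable
   almost everywhere, so deriv is additive outside a null set. The derivative of J at the parameter
   0 therefore vanishes. After integration by parts for z and Fubini for the fractional integrals
   it reads int_a^T (psi * eta + F * eta') = 0 for every C1 function eta, where F is the right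
   fractional integral of order 1 - alpha of L_v + M l_v and psi collects the remaining terms. The
   lemma of du Bois-Reymond gives F(x) = int_a^x psi, which contains both the equation (F' = psi,
   and -F' is the Riemann-Liouville derivative) and the natural boundary condition F(a) = 0. The
   condition L[y](T) = 0 comes from varying T alone. *)

theory Submission
  imports Defs
begin

text \<open>Along \<open>y\<close> the coefficients are only continuous, so \<open>F\<close> cannot
  be assumed differentiable and the derivative cannot be moved from \<open>eta'\<close> onto it.
  Hence the detour through du Bois-Reymond, where differentiability of \<open>F\<close> is a
  conclusion. It concerns the sum \<open>L_v + M l_v\<close> only; nothing is obtained for the two
  summands separately.

  The costly step is additivity of \<open>deriv\<close>. Absolute continuity is given in
  epsilon-delta form, and where \<open>y\<close> is not differentiable \<open>deriv y\<close> is an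
  unspecified value. Differentiability almost everywhere is derived from Vitali coverings; the
  exceptional sets are not known to be measurable, so the arguments use measurable supersets.

  The kernels are singular at the moving limit of integration. Extension by zero turns fractional
  integrals into convolutions on the line, where a substitution moves the parameter away from the
  singularity.\<close>

section \<open>Increments over divisions\<close>

text \<open>The increments carry their signs, unlike those in the definition of absolute continuity.
  Signed increments telescope, so the sum depends only on the covered set and two unrelated
  divisions can be compared.\<close>

definition increment_sum :: "(real \<Rightarrow> real) \<Rightarrow> real set set \<Rightarrow> real" where
  "increment_sum f d = (\<Sum>k\<in>d. f (Sup k) - f (Inf k))"

lemma increment_sum_division_interval:
  fixes f :: "real \<Rightarrow> real"
  assumes "a \<le> b" and d: "d division_of {a..b}"
  shows "increment_sum f d = f b - f a"
proof -
  let ?f = "\<lambda>K::real set. if K = {} then 0 else f (interval_upperbound K) - f (interval_lowerbound K)"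
  interpret operative_real plus 0 ?f
    rewrites "comm_monoid_set.F (+) 0 = sum"
    by standard[1] (auto simp add: sum_def)
  have "sum ?f d = ?f (cbox a b)"
    using division[of d a b] d by simp
  moreover have "sum ?f d = increment_sum f d"
    unfolding increment_sum_def using division_ofD(3)[OF d] division_ofD(4)[OF d]
    by (intro sum.cong) auto
  ultimately show ?thesis using \<open>a \<le> b\<close> by simp
qed

text \<open>Both divisions are completed by the same remainder \<open>R\<close> to divisions of one
  large interval; there the sums telescope to the same value, and the contribution of
  \<open>R\<close> cancels.\<close>

lemma increment_sum_division_unique:
  fixes f :: "real \<Rightarrow> real"
  assumes d: "d division_of S" and e: "e division_of S"
  shows "increment_sum f d = increment_sum f e"
proof (cases "S = {}")
  case True
  then show ?thesis using d e by simp
next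
  case False
  obtain a b where "S \<subseteq> cbox a b"
    using elementary_subset_cbox[OF d] by auto
  then have S: "S \<subseteq> {a..b}" "a \<le> b" using False by auto
  obtain q where q: "d \<subseteq> q" "q division_of {a..b}"
    using partial_division_extend_interval[of d a b] d S division_ofD(6)[OF d]
    by (metis box_real(2) division_of_union_self)
  \<comment> \<open>\<open>R\<close> comes from extending \<open>d\<close>, but its members are
    interior-disjoint from all of \<open>S\<close>, so it completes every other division of
    \<open>S\<close> as well.\<close>
  define R where "R = q - d"
  have R: "R division_of \<Union>R"
    using q unfolding R_def by (metis Diff_subset division_of_subset division_of_union_self)
  note qD = division_ofD[OF q(2)]
  have int1: "interior S \<inter> interior T = {}" if "T \<in> R" for T
  proof -
    have "interior T \<inter> interior (\<Union>d) = {}"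
    proof (rule Int_interior_Union_intervals)
      show "finite d" using d by auto
      show "open (interior T)" by simp
      show "\<And>T. T \<in> d \<Longrightarrow> \<exists>a b. T = cbox a b" using division_ofD(4)[OF d] .
      show "\<And>U. U \<in> d \<Longrightarrow> interior T \<inter> interior U = {}"
        using that qD(5)[of T] q(1) unfolding R_def by blast
    qed
    then show ?thesis using division_ofD(6)[OF d] by (simp add: Int_commute)
  qed
  have int: "interior S \<inter> interior (\<Union>R) = {}"
  proof (rule Int_interior_Union_intervals)
    show "finite R" using R by auto
    show "\<And>T. T \<in> R \<Longrightarrow> \<exists>a b. T = cbox a b" using division_ofD(4)[OF R] .
  qed (auto simp: int1)
  have cover: "S \<union> \<Union>R = {a..b}"
  proof -
    have "S \<union> \<Union>R = \<Union>q" using division_ofD(6)[OF d] q(1) unfolding R_def by blast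
    then show ?thesis using qD(6) by simp
  qed
  have key: "increment_sum f c + increment_sum f R = f b - f a" if c: "c division_of S" for c
  proof -
    have "(c \<union> R) division_of {a..b}"
      using division_disjoint_union[OF c R int] cover by simp
    then have "increment_sum f (c \<union> R) = f b - f a"
      by (rule increment_sum_division_interval[OF S(2)])
    \<comment> \<open>\<open>c\<close> and \<open>R\<close> may share members, but only degenerate
      intervals, whose increment is zero.\<close>
    moreover have "f (Sup k) - f (Inf k) = 0" if k: "k \<in> c \<inter> R" for k
    proof -
      obtain u v where uv: "k = {u..v}" "u \<le> v"
        using division_ofD(3,4)[OF R, of k] k by fastforce
      have "interior k \<subseteq> interior S"
        using k division_ofD(2)[OF c] by (intro interior_mono) blast
      then have "{u<..<v} = {}" using int1[of k] k uv(1) by (metis Int_absorb1 IntD2 interior_atLeastAtMost_real)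
      then show ?thesis using uv by simp
    qed
    ultimately show ?thesis
      unfolding increment_sum_def using division_ofD(1)[OF c] division_ofD(1)[OF R]
      by (subst (asm) sum.union_inter_neutral) auto
  qed
  show ?thesis using key[OF d] key[OF e] by simp
qed

lemma division_length:
  fixes d :: "real set set"
  assumes "d division_of S"
  shows "(\<Sum>k\<in>d. Sup k - Inf k) = measure lebesgue S"
proof -
  have "(\<Sum>k\<in>d. Sup k - Inf k) = (\<Sum>k\<in>d. measure lebesgue k)"
  proof (rule sum.cong[OF refl])
    fix k assume "k \<in> d"
    then obtain u v where "k = {u..v}" "u \<le> v"
      using division_ofD(3,4)[OF assms, of k] by fastforce
    then show "Sup k - Inf k = measure lebesgue k" by simp
  qed
  then show ?thesis using content_division[OF assms] by simp
qed

lemma absolutely_continuous_increment_sum: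
  assumes ac: "absolutely_continuous_fun_on {a..b} f" and "0 < \<epsilon>"
  obtains \<delta> where "0 < \<delta>"
    "\<And>d. d division_of \<Union>d \<Longrightarrow> \<Union>d \<subseteq> {a..b} \<Longrightarrow> measure lebesgue (\<Union>d) < \<delta> \<Longrightarrow>
        \<bar>increment_sum f d\<bar> < \<epsilon>"
proof -
  obtain \<delta> where \<delta>: "0 < \<delta>"
    "\<And>d. d division_of \<Union>d \<Longrightarrow> \<Union>d \<subseteq> {a..b} \<Longrightarrow> (\<Sum>k\<in>d. Sup k - Inf k) < \<delta> \<Longrightarrow>
      (\<Sum>k\<in>d. \<bar>f (Sup k) - f (Inf k)\<bar>) < \<epsilon>"
    using ac[unfolded absolutely_continuous_fun_on_def, rule_format, OF \<open>0 < \<epsilon>\<close>] by metis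
  show ?thesis
  proof (rule that[OF \<delta>(1)])
    fix d :: "real set set"
    assume d: "d division_of \<Union>d" "\<Union>d \<subseteq> {a..b}" "measure lebesgue (\<Union>d) < \<delta>"
    then have "(\<Sum>k\<in>d. \<bar>f (Sup k) - f (Inf k)\<bar>) < \<epsilon>"
      using \<delta>(2)[of d] division_length[OF d(1)] by simp
    then show "\<bar>increment_sum f d\<bar> < \<epsilon>"
      unfolding increment_sum_def 
      by (rule le_less_trans[OF sum_abs[of "\<lambda>k. f (Sup k) - f (Inf k)" d]])
  qed
qed

text \<open>An extension \<open>r\<close> of \<open>e\<close> that divides the union of
  \<open>d\<close> has the same increment sum as \<open>d\<close>. The difference is therefore the
  increment over \<open>r - e\<close>, whose total length is the difference of the measures.\<close>

lemma absolutely_continuous_increment_sum_diff: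
  assumes ac: "absolutely_continuous_fun_on {a..b} f" and "0 < \<epsilon>"
  obtains \<delta> where "0 < \<delta>"
    "\<And>d e. d division_of \<Union>d \<Longrightarrow> e division_of \<Union>e \<Longrightarrow> \<Union>e \<subseteq> \<Union>d \<Longrightarrow> \<Union>d \<subseteq> {a..b} \<Longrightarrow>
        measure lebesgue (\<Union>d) - measure lebesgue (\<Union>e) < \<delta> \<Longrightarrow>
        \<bar>increment_sum f d - increment_sum f e\<bar> < \<epsilon>"
proof -
  obtain \<delta> where \<delta>: "0 < \<delta>"
    "\<And>d. d division_of \<Union>d \<Longrightarrow> \<Union>d \<subseteq> {a..b} \<Longrightarrow> measure lebesgue (\<Union>d) < \<delta> \<Longrightarrow>
        \<bar>increment_sum f d\<bar> < \<epsilon>"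
    using absolutely_continuous_increment_sum[OF assms] by blast
  show ?thesis
  proof (rule that[OF \<delta>(1)])
    fix d e :: "real set set"
    assume d: "d division_of \<Union>d" and e: "e division_of \<Union>e" and sub: "\<Union>e \<subseteq> \<Union>d" "\<Union>d \<subseteq> {a..b}"
      and m: "measure lebesgue (\<Union>d) - measure lebesgue (\<Union>e) < \<delta>"
    obtain r where r: "e \<subseteq> r" "r division_of \<Union>d"
      using partial_division_extend[OF e d sub(1)] by blast
    have fin: "finite r" using r by auto
    have rest: "(r - e) division_of \<Union>(r - e)"
      using r by (metis Diff_subset division_of_subset division_of_union_self)
    have split: "sum h r = sum h (r - e) + sum h e" for h :: "real set \<Rightarrow> real"
      using sum.subset_diff[OF r(1) fin] by simp
    have "measure lebesgue (\<Union>(r - e)) = measure lebesgue (\<Union>d) - measure lebesgue (\<Union>e)"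
      using split[of "\<lambda>k. Sup k - Inf k"] division_length[OF rest] division_length[OF e]
        division_length[OF r(2)] by simp
    moreover have "\<Union>(r - e) \<subseteq> {a..b}" using sub division_ofD(6)[OF r(2)] by blast
    ultimately have "\<bar>increment_sum f (r - e)\<bar> < \<epsilon>"
      using \<delta>(2)[OF rest] m by simp
    moreover have "increment_sum f (r - e) = increment_sum f r - increment_sum f e"
      using split[of "\<lambda>k. f (Sup k) - f (Inf k)"] unfolding increment_sum_def by simp
    ultimately show "\<bar>increment_sum f d - increment_sum f e\<bar> < \<epsilon>"
      using increment_sum_division_unique[OF d r(2), of f] by simp
  qed
qed

section \<open>Vitali coverings, absolute continuity and differentiability almost everywhere\<close>

text \<open>\<open>S\<close> need not be measurable, so the quality of the covering is expressed by
  a measurable superset \<open>W\<close>: all the countably many disjoint Vitali intervals plus the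
  null rest of \<open>S\<close>. Finitely many of them already have nearly the measure of
  \<open>W\<close>.\<close>

lemma Vitali_covering_intervals:
  fixes S U :: "real set" and P :: "real set \<Rightarrow> bool"
  assumes U: "open U" "U \<in> lmeasurable" and SU: "S \<subseteq> U" and "0 < \<epsilon>"
    and P: "\<And>x d. x \<in> S \<Longrightarrow> 0 < d \<Longrightarrow> \<exists>u v. u < v \<and> v - u < d \<and> x \<in> {u..v} \<and> P {u..v}"
  obtains d W where "d division_of \<Union>d" "\<Union>d \<subseteq> U" "\<And>k. k \<in> d \<Longrightarrow> P k"
    "W \<in> lmeasurable" "S \<subseteq> W" "measure lebesgue W \<le> measure lebesgue (\<Union>d) + \<epsilon>"
proof -
  define K where "K = {(c::real, r::real). 0 < r \<and> cball c r \<subseteq> U \<and> P (cball c r)}"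
  obtain C where C: "countable C" "C \<subseteq> K"
     "pairwise (\<lambda>i j. disjnt (cball (fst i) (snd i)) (cball (fst j) (snd j))) C"
     "negligible (S - (\<Union>i \<in> C. cball (fst i) (snd i)))"
  proof (rule Vitali_covering_theorem_cballs[where K=K and S=S and a=fst and r=snd])
    show "\<And>i. i \<in> K \<Longrightarrow> 0 < snd i" by (auto simp: K_def)
    fix x d :: real assume xd: "x \<in> S" "0 < d"
    obtain e where e: "0 < e" "ball x e \<subseteq> U"
      using U(1) SU xd(1) openE by blast
    obtain u v where uv: "u < v" "v - u < min d e" "x \<in> {u..v}" "P {u..v}"
      using P[OF xd(1), of "min d e"] xd(2) e(1) by auto
    \<comment> \<open>On the line closed balls are closed intervals, and the Vitali theorem only
      asks that the ball contain \<open>x\<close>; so \<open>x\<close> may lie anywhere in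
      \<open>{u..v}\<close>, even at an end.\<close>
    define c r where "c = (u + v) / 2" and "r = (v - u) / 2"
    have cb: "cball c r = {u..v}"
      by (simp add: cball_eq_atLeastAtMost c_def r_def field_simps)
    have "{u..v} \<subseteq> ball x e" using uv by (auto simp: dist_real_def)
    then have "(c, r) \<in> K" using cb e uv by (auto simp: K_def r_def)
    moreover have "x \<in> cball c r" "r < d" using uv cb by (auto simp: r_def)
    ultimately show "\<exists>i. i \<in> K \<and> x \<in> cball (fst i) (snd i) \<and> snd i < d"
      by (metis fst_conv snd_conv)
  qed blast
  define B where "B = (\<lambda>i. cball (fst i) (snd i)) ` (C :: (real \<times> real) set)"
  have BU: "\<And>k. k \<in> B \<Longrightarrow> k \<subseteq> U" and BP: "\<And>k. k \<in> B \<Longrightarrow> P k"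
    and Bint: "\<And>k. k \<in> B \<Longrightarrow> \<exists>u v. u < v \<and> k = {u..v}"
    using C(2) by (force simp: B_def K_def cball_eq_atLeastAtMost)+
  have Bdisj: "k \<inter> k' = {}" if "k \<in> B" "k' \<in> B" "k \<noteq> k'" for k k'
    using that C(3) by (force simp: B_def pairwise_def disjnt_def)
  have Bm: "k \<in> lmeasurable" if "k \<in> B" for k using that by (auto simp: B_def)
  have cB: "countable B" using C(1) by (simp add: B_def)
  have "\<Union>B \<in> sets lebesgue"
    using cB Bm by (intro sets.countable_Union) (auto simp: fmeasurable_def)
  then have UBm: "\<Union>B \<in> lmeasurable"
    using BU U(2) by (intro fmeasurableI2[OF U(2)]) auto
  obtain d where d: "d \<subseteq> B" "finite d" "measure lebesgue (\<Union>B) - \<epsilon> < measure lebesgue (\<Union>d)"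
  proof (rule measure_countable_Union_approachable[OF cB \<open>0 < \<epsilon>\<close>, of "measure lebesgue U"])
    fix D' assume "D' \<subseteq> B" "finite D'"
    then show "measure lebesgue (\<Union>D') \<le> measure lebesgue U"
      using BU Bm U(2) 
      by (intro measure_mono_fmeasurable fmeasurableD fmeasurable.finite_Union) auto
  qed (use Bm in auto)
  have ddiv: "d division_of \<Union>d"
  proof (rule division_ofI)
    fix k assume k: "k \<in> d"
    then obtain u v where "u < v" "k = {u..v}" using Bint d(1) by blast
    then show "k \<noteq> {}" "\<exists>a b. k = cbox a b" by auto
    fix k' assume "k' \<in> d" "k \<noteq> k'"
    then have "k \<inter> k' = {}" using k Bdisj d(1) by blast
    then show "interior k \<inter> interior k' = {}"
      using interior_subset by blast
  qed (use d in auto)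
  define W where "W = \<Union>B \<union> (S - \<Union>B)"
  have neg: "negligible (S - \<Union>B)" using C(4) by (simp add: B_def)
  have W: "W \<in> lmeasurable"
    unfolding W_def using neg
    by (intro fmeasurable.Un UBm fmeasurableI_null_sets) (simp add: negligible_iff_null_sets)
  have "measure lebesgue W = measure lebesgue (\<Union>B)"
    unfolding W_def using neg
    by (intro measure_Un_null_set fmeasurableD[OF UBm]) (simp add: negligible_iff_null_sets)
  show ?thesis
    by (rule that[OF ddiv _ _ W]) (use d BU BP \<open>measure lebesgue W = _\<close> in \<open>auto simp: W_def\<close>)
qed

lemma absolutely_continuous_fun_onE:
  assumes "absolutely_continuous_fun_on S f" and "0 < \<epsilon>"
  obtains \<delta> where "0 < \<delta>" "\<And>d. d division_of \<Union>d \<Longrightarrow> \<Union>d \<subseteq> S \<Longrightarrow>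
      (\<Sum>k\<in>d. Sup k - Inf k) < \<delta> \<Longrightarrow> (\<Sum>k\<in>d. \<bar>f (Sup k) - f (Inf k)\<bar>) < \<epsilon>"
proof -
  have "\<exists>\<delta>>0. \<forall>d. d division_of \<Union>d \<and> \<Union>d \<subseteq> S \<and> (\<Sum>k\<in>d. Sup k - Inf k) < \<delta> \<longrightarrow>
      (\<Sum>k\<in>d. \<bar>f (Sup k) - f (Inf k)\<bar>) < \<epsilon>"
    using assms(1)[unfolded absolutely_continuous_fun_on_def, THEN spec, THEN mp, OF assms(2)] .
  then obtain \<delta> where \<delta>: "0 < \<delta> \<and> (\<forall>d. d division_of \<Union>d \<and> \<Union>d \<subseteq> S \<and> (\<Sum>k\<in>d. Sup k - Inf k) < \<delta> \<longrightarrow>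
      (\<Sum>k\<in>d. \<bar>f (Sup k) - f (Inf k)\<bar>) < \<epsilon>)"
    by (rule exE)
  show ?thesis
    by (rule that[OF \<delta>[THEN conjunct1]]) (rule \<delta>[THEN conjunct2, THEN spec, THEN mp], intro conjI)
qed

lemma absolutely_continuous_fun_on_lincomb:
  assumes f: "absolutely_continuous_fun_on S f" and g: "absolutely_continuous_fun_on S g"
  shows "absolutely_continuous_fun_on S (\<lambda>x. f x + c * g x)"
  unfolding absolutely_continuous_fun_on_def
proof (intro allI impI)
  fix \<epsilon> :: real assume "0 < \<epsilon>"
  then have e: "0 < \<epsilon> / 2" "0 < \<epsilon> / (2 * (\<bar>c\<bar> + 1))" by auto
  obtain \<delta>1 where \<delta>1: "0 < \<delta>1" "\<And>d. d division_of \<Union>d \<Longrightarrow> \<Union>d \<subseteq> S \<Longrightarrow>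
      (\<Sum>k\<in>d. Sup k - Inf k) < \<delta>1 \<Longrightarrow> (\<Sum>k\<in>d. \<bar>f (Sup k) - f (Inf k)\<bar>) < \<epsilon> / 2"
    by (rule absolutely_continuous_fun_onE[OF f e(1)]) blast
  obtain \<delta>2 where \<delta>2: "0 < \<delta>2" "\<And>d. d division_of \<Union>d \<Longrightarrow> \<Union>d \<subseteq> S \<Longrightarrow>
      (\<Sum>k\<in>d. Sup k - Inf k) < \<delta>2 \<Longrightarrow>
      (\<Sum>k\<in>d. \<bar>g (Sup k) - g (Inf k)\<bar>) < \<epsilon> / (2 * (\<bar>c\<bar> + 1))"
    by (rule absolutely_continuous_fun_onE[OF g e(2)]) blast
  show "\<exists>\<delta>>0. \<forall>d. d division_of \<Union>d \<and> \<Union>d \<subseteq> S \<and> (\<Sum>k\<in>d. Sup k - Inf k) < \<delta> \<longrightarrow>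
      (\<Sum>k\<in>d. \<bar>f (Sup k) + c * g (Sup k) - (f (Inf k) + c * g (Inf k))\<bar>) < \<epsilon>"
  proof (intro exI[of _ "min \<delta>1 \<delta>2"] conjI allI impI)
    fix d :: "real set set"
    assume d: "d division_of \<Union>d \<and> \<Union>d \<subseteq> S \<and> (\<Sum>k\<in>d. Sup k - Inf k) < min \<delta>1 \<delta>2"
    have "(\<Sum>k\<in>d. \<bar>f (Sup k) + c * g (Sup k) - (f (Inf k) + c * g (Inf k))\<bar>)
        \<le> (\<Sum>k\<in>d. \<bar>f (Sup k) - f (Inf k)\<bar> + \<bar>c\<bar> * \<bar>g (Sup k) - g (Inf k)\<bar>)"
    proof (rule sum_mono)
      fix k
      have "f (Sup k) + c * g (Sup k) - (f (Inf k) + c * g (Inf k))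
          = (f (Sup k) - f (Inf k)) + c * (g (Sup k) - g (Inf k))" by (simp add: algebra_simps)
      then show "\<bar>f (Sup k) + c * g (Sup k) - (f (Inf k) + c * g (Inf k))\<bar>
          \<le> \<bar>f (Sup k) - f (Inf k)\<bar> + \<bar>c\<bar> * \<bar>g (Sup k) - g (Inf k)\<bar>"
        using abs_triangle_ineq[of "f (Sup k) - f (Inf k)" "c * (g (Sup k) - g (Inf k))"]
        by (simp add: abs_mult)
    qed
    also have "\<dots> = (\<Sum>k\<in>d. \<bar>f (Sup k) - f (Inf k)\<bar>) + \<bar>c\<bar> * (\<Sum>k\<in>d. \<bar>g (Sup k) - g (Inf k)\<bar>)"
      by (simp add: sum.distrib sum_distrib_left)
    also have "\<dots> < \<epsilon> / 2 + \<epsilon> / 2"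
    proof (rule add_less_le_mono)
      show "(\<Sum>k\<in>d. \<bar>f (Sup k) - f (Inf k)\<bar>) < \<epsilon> / 2" using \<delta>1(2)[of d] d by simp
      have "\<bar>c\<bar> * (\<Sum>k\<in>d. \<bar>g (Sup k) - g (Inf k)\<bar>) \<le> \<bar>c\<bar> * (\<epsilon> / (2 * (\<bar>c\<bar> + 1)))"
        using \<delta>2(2)[of d] d by (intro mult_left_mono) auto
      also have "\<dots> \<le> \<epsilon> / 2" using \<open>0 < \<epsilon>\<close> by (simp add: field_simps)
      finally show "\<bar>c\<bar> * (\<Sum>k\<in>d. \<bar>g (Sup k) - g (Inf k)\<bar>) \<le> \<epsilon> / 2" .
    qed
    finally show "(\<Sum>k\<in>d. \<bar>f (Sup k) + c * g (Sup k) - (f (Inf k) + c * g (Inf k))\<bar>) < \<epsilon>" by simp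
  qed (use \<delta>1 \<delta>2 in auto)
qed

lemma Lipschitz_imp_absolutely_continuous:
  assumes lip: "\<And>x y. x \<in> S \<Longrightarrow> y \<in> S \<Longrightarrow> \<bar>f x - f y\<bar> \<le> B * \<bar>x - y\<bar>"
  shows "absolutely_continuous_fun_on S f"
  unfolding absolutely_continuous_fun_on_def
proof (intro allI impI)
  fix \<epsilon> :: real assume "0 < \<epsilon>"
  show "\<exists>\<delta>>0. \<forall>d. d division_of \<Union>d \<and> \<Union>d \<subseteq> S \<and> (\<Sum>k\<in>d. Sup k - Inf k) < \<delta> \<longrightarrow>
      (\<Sum>k\<in>d. \<bar>f (Sup k) - f (Inf k)\<bar>) < \<epsilon>"
  proof (intro exI[of _ "\<epsilon> / (\<bar>B\<bar> + 1)"] conjI allI impI)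
    fix d :: "real set set"
    assume d: "d division_of \<Union>d \<and> \<Union>d \<subseteq> S \<and> (\<Sum>k\<in>d. Sup k - Inf k) < \<epsilon> / (\<bar>B\<bar> + 1)"
    have "\<bar>f (Sup k) - f (Inf k)\<bar> \<le> (\<bar>B\<bar> + 1) * (Sup k - Inf k)" if k: "k \<in> d" for k
    proof -
      obtain u v where uv: "k = {u..v}" "u \<le> v"
        using division_ofD(3,4)[of d "\<Union>d" k] k d by fastforce
      then have "u \<in> k" "v \<in> k" by auto
      then have "u \<in> S" "v \<in> S" using k d by auto
      then have "\<bar>f v - f u\<bar> \<le> B * (v - u)" using lip[of v u] uv(2) by simp
      also have "\<dots> \<le> (\<bar>B\<bar> + 1) * (v - u)" using uv(2) by (intro mult_right_mono) auto
      finally show ?thesis using uv by simp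
    qed
    then have "(\<Sum>k\<in>d. \<bar>f (Sup k) - f (Inf k)\<bar>) \<le> (\<bar>B\<bar> + 1) * (\<Sum>k\<in>d. Sup k - Inf k)"
      unfolding sum_distrib_left by (rule sum_mono)
    also have "\<dots> < \<epsilon>" using d by (simp add: field_simps)
    finally show "(\<Sum>k\<in>d. \<bar>f (Sup k) - f (Inf k)\<bar>) < \<epsilon>" .
  qed (use \<open>0 < \<epsilon>\<close> in auto)
qed

lemma absolutely_continuous_imp_continuous:
  assumes ac: "absolutely_continuous_fun_on {a..b} f"
  shows "continuous_on {a..b} f"
proof (rule continuous_onI)
  fix x \<epsilon> :: real assume x: "x \<in> {a..b}" "0 < \<epsilon>"
  obtain \<delta> where \<delta>: "0 < \<delta>" "\<And>d. d division_of \<Union>d \<Longrightarrow> \<Union>d \<subseteq> {a..b} \<Longrightarrow>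
      measure lebesgue (\<Union>d) < \<delta> \<Longrightarrow> \<bar>increment_sum f d\<bar> < \<epsilon>"
    using absolutely_continuous_increment_sum[OF ac x(2)] by blast
  show "\<exists>d>0. \<forall>x'\<in>{a..b}. dist x' x < d \<longrightarrow> dist (f x') (f x) \<le> \<epsilon>"
  proof (intro exI[of _ \<delta>] conjI ballI impI \<delta>(1))
    fix x' assume x': "x' \<in> {a..b}" "dist x' x < \<delta>"
    have main: "\<bar>f v - f u\<bar> < \<epsilon>" if "u \<in> {a..b}" "v \<in> {a..b}" "u \<le> v" "v - u < \<delta>" for u v
    proof -
      have "{ {u..v} } division_of {u..v}"
        using division_of_self[of u v] that(3) by simp
      then have "\<bar>increment_sum f { {u..v} }\<bar> < \<epsilon>"
        using that by (intro \<delta>(2)) simp_all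
      then show ?thesis using that(3) by (simp add: increment_sum_def)
    qed
    show "dist (f x') (f x) \<le> \<epsilon>"
      using main[of x x'] main[of x' x] x(1) x' unfolding dist_real_def by linarith
  qed
qed

text \<open>
  Cover \<open>S\<close> up to small measure by intervals on which \<open>f\<close> decreases at rate \<open>r\<close>, and then the part of
  \<open>S\<close> inside them by intervals on which \<open>f\<close> increases at rate \<open>r\<close>. Both families fill the outer measure
  \<open>m\<close> of \<open>S\<close> almost entirely, so by absolute continuity the increments of \<open>f\<close> over them nearly agree,
  although one is about \<open>- r m\<close> and the other nonnegative.
\<close>
lemma oscillating_quotients_negligible:
  assumes ac: "absolutely_continuous_fun_on {a..b} f" and "0 < r" and S: "S \<subseteq> {a<..<b}"
    and up: "\<And>x d. x \<in> S \<Longrightarrow> 0 < d \<Longrightarrow>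
        \<exists>u v. u < v \<and> v - u < d \<and> x \<in> {u..v} \<and> r * (v - u) < f v - f u"
    and dn: "\<And>x d. x \<in> S \<Longrightarrow> 0 < d \<Longrightarrow>
        \<exists>u v. u < v \<and> v - u < d \<and> x \<in> {u..v} \<and> f v - f u < - r * (v - u)"
  shows "negligible S"
proof -
  \<comment> \<open>\<open>m\<close> is the outer measure of \<open>S\<close>, which is not known to
    be measurable.\<close>
  define \<M> where "\<M> = measure lebesgue ` {W. W \<in> lmeasurable \<and> S \<subseteq> W}"
  define m where "m = Inf \<M>"
  have nonempty: "\<M> \<noteq> {}" using S by (auto simp: \<M>_def intro!: exI[of _ "{a<..<b}"])
  have bdd: "bdd_below \<M>" by (auto simp: \<M>_def intro!: bdd_belowI[of _ 0])
  have approx: "\<exists>W. W \<in> lmeasurable \<and> S \<subseteq> W \<and> measure lebesgue W < c" if "m < c" for c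
    using cInf_lessD[OF nonempty that[unfolded m_def]] unfolding \<M>_def by blast
  have m_le: "m \<le> measure lebesgue W" if "W \<in> lmeasurable" "S \<subseteq> W" for W
    unfolding m_def using bdd that by (intro cInf_lower) (auto simp: \<M>_def)
  have "m \<le> 0"
  proof (rule ccontr)
    assume "\<not> m \<le> 0"
    then have "0 < m" by simp
    then have "0 < r * m / 4" using \<open>0 < r\<close> by simp
    then obtain \<delta> where \<delta>: "0 < \<delta>"
      "\<And>d e. d division_of \<Union>d \<Longrightarrow> e division_of \<Union>e \<Longrightarrow> \<Union>e \<subseteq> \<Union>d \<Longrightarrow> \<Union>d \<subseteq> {a..b} \<Longrightarrow>
        measure lebesgue (\<Union>d) - measure lebesgue (\<Union>e) < \<delta> \<Longrightarrow>
        \<bar>increment_sum f d - increment_sum f e\<bar> < r * m / 4"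
      using absolutely_continuous_increment_sum_diff[OF ac] by blast
    \<comment> \<open>\<open>m / 4\<close> leaves the union of \<open>d\<close> a measure of at
      least \<open>3 / 4 * m\<close>. The excess of \<open>U\<close> over \<open>m\<close> and the
      covering loss of \<open>e\<close>, each at most \<open>\<eta>\<close>, together stay below
      \<open>\<delta>\<close>.\<close>
    define \<eta> where "\<eta> = min (m / 4) (\<delta> / 4)"
    have \<eta>: "0 < \<eta>" "\<eta> \<le> m / 4" "\<eta> \<le> \<delta> / 4" using \<open>0 < m\<close> \<delta>(1) by (auto simp: \<eta>_def)
    obtain W0 where W0: "W0 \<in> lmeasurable" "S \<subseteq> W0" "measure lebesgue W0 < m + \<eta> / 2"
      using approx[of "m + \<eta> / 2"] \<eta>(1) by auto
    obtain G where G: "open G" "W0 \<subseteq> G" "G - W0 \<in> lmeasurable"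
        "emeasure lebesgue (G - W0) < ennreal (\<eta> / 2)"
      by (rule sets_lebesgue_outer_open[OF fmeasurableD[OF W0(1)], of "\<eta> / 2"]) (use \<eta>(1) in auto)
    define U where "U = G \<inter> {a<..<b}"
    have U: "open U" "U \<in> lmeasurable" "S \<subseteq> U"
      using G(1,2) W0(2) S unfolding U_def
      by (auto intro!: lmeasurable_open bounded_Int)
    have mU: "measure lebesgue U < m + \<eta>"
    proof -
      have "measure lebesgue (G - W0) < \<eta> / 2"
        using G(3,4) \<eta>(1) by (simp add: emeasure_eq_measure2 ennreal_less_iff)
      moreover have "measure lebesgue U \<le> measure lebesgue (W0 \<union> (G - W0))"
        using G(3) W0(1) U(2) by (intro measure_mono_fmeasurable fmeasurable.Un) (auto simp: U_def)
      moreover have "\<dots> \<le> measure lebesgue W0 + measure lebesgue (G - W0)"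
        using G(3) W0(1) by (intro measure_Un_le) (auto dest: fmeasurableD)
      ultimately show ?thesis using W0(3) by linarith
    qed
    obtain d W where d: "d division_of \<Union>d" "\<Union>d \<subseteq> U"
        "\<And>k. k \<in> d \<Longrightarrow> f (Sup k) - f (Inf k) < - r * (Sup k - Inf k)"
      and W: "W \<in> lmeasurable" "S \<subseteq> W" "measure lebesgue W \<le> measure lebesgue (\<Union>d) + \<eta>"
    proof (rule Vitali_covering_intervals[OF U \<eta>(1), where P="\<lambda>k. f (Sup k) - f (Inf k) < - r * (Sup k - Inf k)"])
      fix x e :: real assume "x \<in> S" "0 < e"
      from dn[OF this] show "\<exists>u v. u < v \<and> v - u < e \<and> x \<in> {u..v} \<and>
          f (Sup {u..v}) - f (Inf {u..v}) < - r * (Sup {u..v} - Inf {u..v})"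
        by fastforce
    qed blast
    \<comment> \<open>A Vitali covering needs an open set. Passing to interiors keeps
      \<open>e\<close> inside the union of \<open>d\<close> and discards only finitely many
      endpoints.\<close>
    define V where "V = (\<Union>k\<in>d. interior k)"
    have dm: "\<Union>d \<in> lmeasurable" using d(1) by (metis content_division(1) lmeasurable_division)
    have Vd: "V \<subseteq> \<Union>d" using interior_subset by (auto simp: V_def)
    have V: "open V" by (auto simp: V_def)
    then have Vm: "V \<in> lmeasurable"
      using Vd dm by (intro fmeasurableI2[OF dm]) auto
    have bdry: "negligible (\<Union>d - V)"
    proof (rule negligible_subset)
      show "\<Union>d - V \<subseteq> (\<Union>k\<in>d. k - interior k)" by (auto simp: V_def)
      show "negligible (\<Union>k\<in>d. k - interior k)"
      proof (rule negligible_Union[of "(\<lambda>k. k - interior k) ` d", simplified])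
        show "finite ((\<lambda>k. k - interior k) ` d)" using d(1) by auto
        fix t assume "t \<in> (\<lambda>k. k - interior k) ` d"
        then obtain k where k: "k \<in> d" "t = k - interior k" by auto
        then obtain u v where "k = cbox u v" using division_ofD(4)[OF d(1)] by blast
        then have "k - interior k \<subseteq> {u, v}" by auto
        then show "negligible t" using k(2) by (metis negligible_finite finite.simps negligible_subset)
      qed
    qed
    obtain e W' where e: "e division_of \<Union>e" "\<Union>e \<subseteq> V"
        "\<And>k. k \<in> e \<Longrightarrow> r * (Sup k - Inf k) < f (Sup k) - f (Inf k)"
      and W': "W' \<in> lmeasurable" "S \<inter> V \<subseteq> W'" "measure lebesgue W' \<le> measure lebesgue (\<Union>e) + \<eta>"
    proof (rule Vitali_covering_intervals[OF V Vm _ \<eta>(1), where P="\<lambda>k. r * (Sup k - Inf k) < f (Sup k) - f (Inf k)" and S="S \<inter> V"])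
      fix x e :: real assume "x \<in> S \<inter> V" "0 < e"
      then show "\<exists>u v. u < v \<and> v - u < e \<and> x \<in> {u..v} \<and>
          r * (Sup {u..v} - Inf {u..v}) < f (Sup {u..v}) - f (Inf {u..v})"
        using up[of x e] by fastforce
    qed auto
    \<comment> \<open>The three sets together cover \<open>S\<close>, so their measure is at least
      \<open>m\<close>. As \<open>U\<close> exceeds \<open>m\<close> by less than
      \<open>\<eta>\<close>, the intervals of \<open>e\<close> must fill the union of
      \<open>d\<close> almost completely.\<close>
    have "m \<le> measure lebesgue (W' \<union> (U - \<Union>d) \<union> (\<Union>d - V))"
      using U(3) W' U(2) dm Vm by (intro m_le fmeasurable.Un fmeasurable_Diff) (auto simp: fmeasurableD)
    also have "\<dots> \<le> measure lebesgue (W' \<union> (U - \<Union>d)) + measure lebesgue (\<Union>d - V)"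
      using W' U(2) dm Vm by (intro measure_Un_le) (auto simp: fmeasurableD)
    also have "measure lebesgue (\<Union>d - V) = 0"
      using bdry by (rule negligible_imp_measure0)
    also have "measure lebesgue (W' \<union> (U - \<Union>d)) \<le> measure lebesgue W' + measure lebesgue (U - \<Union>d)"
      using W' U(2) dm by (intro measure_Un_le) (auto simp: fmeasurableD)
    also have "measure lebesgue (U - \<Union>d) = measure lebesgue U - measure lebesgue (\<Union>d)"
      using measurable_measure_Diff[OF U(2) _ d(2)] dm by (simp add: fmeasurableD)
    finally have small: "measure lebesgue (\<Union>d) - measure lebesgue (\<Union>e) < \<delta>"
      using W'(3) mU \<eta> \<delta>(1) by linarith
    have "U \<subseteq> {a..b}" by (auto simp: U_def)
    then have "\<bar>increment_sum f d - increment_sum f e\<bar> < r * m / 4"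
      using e(2) Vd d(2) by (intro \<delta>(2)[OF d(1) e(1) _ _ small]) blast+
    moreover have "increment_sum f d \<le> - r * measure lebesgue (\<Union>d)"
      unfolding increment_sum_def division_length[OF d(1), symmetric] sum_distrib_left
      using d(3) by (intro sum_mono) (auto intro: less_imp_le)
    moreover have "r * measure lebesgue (\<Union>e) \<le> increment_sum f e"
      unfolding increment_sum_def division_length[OF e(1), symmetric] sum_distrib_left
      using e(3) by (intro sum_mono) (auto intro: less_imp_le)
    moreover have "0 \<le> r * measure lebesgue (\<Union>e)" using \<open>0 < r\<close> by simp
    moreover have "r * (3 / 4 * m) \<le> r * measure lebesgue (\<Union>d)"
      using m_le[OF W(1,2)] W(3) \<eta>(2) \<open>0 < r\<close> by (intro mult_left_mono) auto
    moreover have "0 < r * m" using \<open>0 < r\<close> \<open>0 < m\<close> by simp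
    ultimately show False by (simp add: algebra_simps)
  qed
  show ?thesis
    unfolding negligible_outer_le
  proof (intro allI impI)
    fix e :: real assume "0 < e"
    then have "m < e" using \<open>m \<le> 0\<close> by simp
    then obtain W where "W \<in> lmeasurable" "S \<subseteq> W" "measure lebesgue W < e"
      using approx by blast
    then show "\<exists>T. S \<subseteq> T \<and> T \<in> lmeasurable \<and> measure lebesgue T \<le> e" by (auto intro: less_imp_le)
  qed
qed

text \<open>Intervals on which \<open>f\<close> changes by more than \<open>K\<close> times their
  length have total length below \<open>1 / K\<close> once the sum of these changes is below 1. As
  \<open>K\<close> is arbitrary, the covered set is null.\<close>

lemma infinite_quotients_negligible:
  assumes ac: "absolutely_continuous_fun_on {a..b} f" and S: "S \<subseteq> {a<..<b}"
    and big: "\<And>x d K. x \<in> S \<Longrightarrow> 0 < d \<Longrightarrow>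
        \<exists>u v. u < v \<and> v - u < d \<and> x \<in> {u..v} \<and> K * (v - u) < \<bar>f v - f u\<bar>"
  shows "negligible S"
proof -
  obtain \<delta> where \<delta>: "0 < \<delta>" "\<And>d. d division_of \<Union>d \<Longrightarrow> \<Union>d \<subseteq> {a..b} \<Longrightarrow>
      (\<Sum>k\<in>d. Sup k - Inf k) < \<delta> \<Longrightarrow> (\<Sum>k\<in>d. \<bar>f (Sup k) - f (Inf k)\<bar>) < 1"
    by (rule absolutely_continuous_fun_onE[OF ac zero_less_one]) blast
  \<comment> \<open>Absolute continuity bounds the changes by 1 only for families of total length
    below \<open>\<delta>\<close>; inside a ball of radius \<open>\<delta> / 4\<close> a division
    has total length at most \<open>\<delta> / 2\<close>.\<close>
  have loc: "negligible (S \<inter> ball p (\<delta> / 4))" for p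
    unfolding negligible_outer_le
  proof (intro allI impI)
    fix e :: real assume e: "0 < e"
    \<comment> \<open>One half of \<open>e\<close> bounds the intervals, the other half is the loss
      in the covering.\<close>
    define K where "K = 2 / e"
    have K: "0 < K" using e by (simp add: K_def)
    define U where "U = {a<..<b} \<inter> ball p (\<delta> / 4)"
    have U: "open U" "U \<in> lmeasurable" "S \<inter> ball p (\<delta> / 4) \<subseteq> U"
      using S unfolding U_def by (auto intro!: lmeasurable_open bounded_Int)
    have e2: "0 < e / 2" using e by simp
    obtain d W where d: "d division_of \<Union>d" "\<Union>d \<subseteq> U"
        "\<And>k. k \<in> d \<Longrightarrow> K * (Sup k - Inf k) < \<bar>f (Sup k) - f (Inf k)\<bar>"
      and W: "W \<in> lmeasurable" "S \<inter> ball p (\<delta> / 4) \<subseteq> W" "measure lebesgue W \<le> measure lebesgue (\<Union>d) + e / 2"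
    proof (rule Vitali_covering_intervals[OF U e2, where P="\<lambda>k. K * (Sup k - Inf k) < \<bar>f (Sup k) - f (Inf k)\<bar>"])
      fix x d :: real assume "x \<in> S \<inter> ball p (\<delta> / 4)" "0 < d"
      then show "\<exists>u v. u < v \<and> v - u < d \<and> x \<in> {u..v} \<and>
          K * (Sup {u..v} - Inf {u..v}) < \<bar>f (Sup {u..v}) - f (Inf {u..v})\<bar>"
        using big[of x d K] by fastforce
    qed blast
    have len: "(\<Sum>k\<in>d. Sup k - Inf k) = measure lebesgue (\<Union>d)"
      by (rule division_length[OF d(1)])
    have "\<Union>d \<in> lmeasurable" using d(1) by (rule lmeasurable_division)
    then have "measure lebesgue (\<Union>d) \<le> measure lebesgue (cball p (\<delta> / 4))"
      using d(2) by (intro measure_mono_fmeasurable) (auto simp: U_def fmeasurableD)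
    also have "\<dots> < \<delta>" using \<delta>(1) by (simp add: cball_eq_atLeastAtMost)
    finally have "(\<Sum>k\<in>d. Sup k - Inf k) < \<delta>" using len by simp
    moreover have "U \<subseteq> {a..b}" by (auto simp: U_def)
    ultimately have "(\<Sum>k\<in>d. \<bar>f (Sup k) - f (Inf k)\<bar>) < 1"
      using d(1,2) by (intro \<delta>(2)) blast+
    moreover have "K * (\<Sum>k\<in>d. Sup k - Inf k) \<le> (\<Sum>k\<in>d. \<bar>f (Sup k) - f (Inf k)\<bar>)"
      unfolding sum_distrib_left using d(3) by (intro sum_mono less_imp_le)
    ultimately have "K * measure lebesgue (\<Union>d) < 1" using len by simp
    then have "measure lebesgue (\<Union>d) < e / 2" using e by (simp add: K_def field_simps)
    then have "measure lebesgue W \<le> e" using W(3) by simp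
    then show "\<exists>T. S \<inter> ball p (\<delta> / 4) \<subseteq> T \<and> T \<in> lmeasurable \<and> measure lebesgue T \<le> e"
      using W by blast
  qed
  show ?thesis
  proof (rule locally_negligible_alt[THEN iffD2], rule ballI)
    fix x assume "x \<in> S"
    then have "x \<in> S \<inter> ball x (\<delta> / 4)" using \<delta>(1) by simp
    then show "\<exists>U. openin (top_of_set S) U \<and> x \<in> U \<and> negligible U"
      using loc[of x] openin_open_Int[OF open_ball, of S x "\<delta> / 4"] by blast
  qed
qed

text \<open>The quotient is symmetric in the two endpoints, so an \<open>h\<close> of either sign
  gives an interval with \<open>x\<close> at one end. Limits of difference quotients are thus
  translated into the covering hypotheses.\<close>

lemma frequently_quotient_interval:
  fixes f :: "real \<Rightarrow> real"
  assumes freq: "\<exists>\<^sub>F h in at 0. P ((f (x + h) - f x) / h)" and "0 < d"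
  obtains u v where "u < v" "v - u < d" "x \<in> {u..v}" "P ((f v - f u) / (v - u))"
proof -
  have "\<forall>\<^sub>F h in at (0::real). h \<noteq> 0 \<and> \<bar>h\<bar> < d"
    using \<open>0 < d\<close> by (auto simp: eventually_at dist_real_def)
  with freq have "\<exists>\<^sub>F h in at 0. P ((f (x + h) - f x) / h) \<and> h \<noteq> 0 \<and> \<bar>h\<bar> < d"
    by (rule frequently_eventually_frequently)
  then obtain h where h: "P ((f (x + h) - f x) / h)" "h \<noteq> 0" "\<bar>h\<bar> < d"
    using frequently_ex by fastforce
  show ?thesis
  proof (cases "0 < h")
    case True
    then show ?thesis using h by (intro that[of x "x + h"]) auto
  next
    case False
    have "(f x - f (x + h)) / (x - (x + h)) = (f (x + h) - f x) / h"
      using h(2) by (simp add: field_simps)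
    then show ?thesis using h False by (intro that[of "x + h" x]) auto
  qed
qed

text \<open>If the derivative fails at \<open>x\<close>, either the lower and upper limits of the
  quotients differ and two rationals \<open>p < s\<close> separate them (\<open>E p s\<close>), or
  their common value is infinite (\<open>Z\<close>). Only countably many null sets arise. The
  endpoints are left out because \<open>f\<close> is arbitrary outside
  \<open>{a..b}\<close>.\<close>

theorem absolutely_continuous_imp_differentiable_AE:
  assumes ac: "absolutely_continuous_fun_on {a..b} f"
  shows "negligible {x \<in> {a<..<b}. \<not> (\<exists>D. (f has_real_derivative D) (at x))}"
proof -
  define q where "q x h = (f (x + h) - f x) / h" for x h
  define E where "E p s = {x \<in> {a<..<b}. (\<exists>\<^sub>F h in at 0. q x h < p) \<and> (\<exists>\<^sub>F h in at 0. s < q x h)}" for p s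
  define Z where "Z = {x \<in> {a<..<b}. \<forall>K. \<exists>\<^sub>F h in at 0. K < \<bar>q x h\<bar>}"
  have negE: "negligible (E p s)" if ps: "p < s" for p s
  proof -
    \<comment> \<open>Subtracting the line of slope \<open>c\<close>, halfway between
      \<open>p\<close> and \<open>s\<close>, makes the bounds symmetric: quotients above
      \<open>s\<close> and below \<open>p\<close> become quotients above \<open>r\<close> and below
      \<open>- r\<close>.\<close>
    define c r where "c = (p + s) / 2" and "r = (s - p) / 2"
    define g where "g x = f x + (- c) * x" for x
    have "absolutely_continuous_fun_on {a..b} g"
      unfolding g_def using ac
      by (rule absolutely_continuous_fun_on_lincomb)
        (auto intro: Lipschitz_imp_absolutely_continuous[where B=1])
    moreover have "0 < r" using ps by (simp add: r_def)
    moreover have "E p s \<subseteq> {a<..<b}" by (auto simp: E_def)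
    ultimately show ?thesis
    proof (rule oscillating_quotients_negligible)
      fix x d :: real assume x: "x \<in> E p s" "0 < d"
      have g: "g v - g u = (f v - f u) - c * (v - u)" for u v by (simp add: g_def algebra_simps)
      have rc: "s = c + r" "p = c - r" by (simp_all add: c_def r_def field_simps)
      have "\<exists>\<^sub>F h in at 0. s < (f (x + h) - f x) / h" using x by (simp add: E_def q_def)
      then obtain u v where uv: "u < v" "v - u < d" "x \<in> {u..v}" "s < (f v - f u) / (v - u)"
        using x(2) by (rule frequently_quotient_interval)
      then have "r * (v - u) < g v - g u" by (simp add: g rc field_simps)
      then show "\<exists>u v. u < v \<and> v - u < d \<and> x \<in> {u..v} \<and> r * (v - u) < g v - g u" using uv by blast
      have "\<exists>\<^sub>F h in at 0. (f (x + h) - f x) / h < p" using x by (simp add: E_def q_def)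
      then obtain u v where uv: "u < v" "v - u < d" "x \<in> {u..v}" "(f v - f u) / (v - u) < p"
        using x(2) by (rule frequently_quotient_interval)
      then have "g v - g u < - r * (v - u)" by (simp add: g rc field_simps)
      then show "\<exists>u v. u < v \<and> v - u < d \<and> x \<in> {u..v} \<and> g v - g u < - r * (v - u)" using uv by blast
    qed
  qed
  have negZ: "negligible Z"
  proof (rule infinite_quotients_negligible[OF ac])
    show "Z \<subseteq> {a<..<b}" by (auto simp: Z_def)
    fix x d K :: real assume x: "x \<in> Z" "0 < d"
    have "\<exists>\<^sub>F h in at 0. K < \<bar>(f (x + h) - f x) / h\<bar>" using x by (simp add: Z_def q_def)
    then obtain u v where uv: "u < v" "v - u < d" "x \<in> {u..v}" "K < \<bar>(f v - f u) / (v - u)\<bar>"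
      using x(2) by (rule frequently_quotient_interval)
    then have "K * (v - u) < \<bar>f v - f u\<bar>" by (simp add: abs_divide field_simps)
    then show "\<exists>u v. u < v \<and> v - u < d \<and> x \<in> {u..v} \<and> K * (v - u) < \<bar>f v - f u\<bar>" using uv by blast
  qed
  define N where "N = Z \<union> (\<Union>(p, s) \<in> {(p, s). p \<in> \<rat> \<and> s \<in> \<rat> \<and> p < s}. E p s)"
  have "negligible N"
  proof -
    have "countable {(p, s). p \<in> \<rat> \<and> s \<in> \<rat> \<and> p < (s::real)}"
      by (rule countable_subset[of _ "\<rat> \<times> \<rat>"]) (auto simp: countable_rat)
    then have "negligible (\<Union>(p, s) \<in> {(p, s). p \<in> \<rat> \<and> s \<in> \<rat> \<and> p < s}. E p s)"
      using negE by (intro negligible_countable_Union) auto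
    then show ?thesis using negZ by (simp add: N_def)
  qed
  moreover have "{x \<in> {a<..<b}. \<not> (\<exists>D. (f has_real_derivative D) (at x))} \<subseteq> N"
  proof
    fix x assume x: "x \<in> {x \<in> {a<..<b}. \<not> (\<exists>D. (f has_real_derivative D) (at x))}"
    let ?l = "Liminf (at 0) (\<lambda>h. ereal (q x h))"
    let ?u = "Limsup (at 0) (\<lambda>h. ereal (q x h))"
    show "x \<in> N"
    proof (cases "?l = ?u")
      case True
      then have lim: "((\<lambda>h. ereal (q x h)) \<longlongrightarrow> ?l) (at 0)"
        by (intro Liminf_eq_Limsup) auto
      have "\<bar>?l\<bar> = \<infinity>"
      proof (rule ccontr)
        assume "\<bar>?l\<bar> \<noteq> \<infinity>"
        then obtain D where "?l = ereal D" by (metis ereal_real')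
        then have "(q x \<longlongrightarrow> D) (at 0)" using lim by simp
        then have "(f has_real_derivative D) (at x)" by (simp add: DERIV_def q_def[abs_def])
        then show False using x by blast
      qed
      then have "?l = \<infinity> \<or> ?l = -\<infinity>" by auto
      then have "\<forall>\<^sub>F h in at 0. K < \<bar>q x h\<bar>" for K
      proof
        assume "?l = \<infinity>"
        then have "\<forall>\<^sub>F h in at 0. ereal K < ereal (q x h)"
          using lim by (simp add: tendsto_PInfty)
        then show ?thesis by (rule eventually_mono) auto
      next
        assume "?l = -\<infinity>"
        then have "((\<lambda>h. ereal (q x h)) \<longlongrightarrow> -\<infinity>) (at 0)" using lim by simp
        then have "\<forall>\<^sub>F h in at 0. ereal (q x h) < ereal (- K)"
          unfolding tendsto_MInfty by (rule spec)
        then show ?thesis by (rule eventually_mono) auto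
      qed
      then have "x \<in> Z" using x by (auto simp: Z_def intro!: eventually_frequently)
      then show ?thesis by (simp add: N_def)
    next
      case False
      have "?l \<le> ?u" by (rule Liminf_le_Limsup) simp
      then have "?l < ?u" using False by simp
      then obtain p' where p': "?l < ereal p'" "ereal p' < ?u" using ereal_dense2 by blast
      then obtain s' where "ereal p' < ereal s'" "ereal s' < ?u" using ereal_dense2 by blast
      with p' have ps: "?l < ereal p'" "p' < s'" "ereal s' < ?u" by simp_all
      obtain m where m: "p' < m" "m < s'" using ps(2) dense by blast
      obtain p0 s0 where r: "p0 \<in> \<rat>" "s0 \<in> \<rat>" "p' < p0" "p0 < m" "m < s0" "s0 < s'"
        using Rats_dense_in_real[OF m(1)] Rats_dense_in_real[OF m(2)] by blast
      have "\<exists>\<^sub>F h in at 0. q x h < p0"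
      proof (rule ccontr)
        assume "\<not> (\<exists>\<^sub>F h in at 0. q x h < p0)"
        then have "\<forall>\<^sub>F h in at 0. ereal p0 \<le> ereal (q x h)" by (simp add: not_frequently not_less)
        then have "ereal p0 \<le> ?l" by (rule Liminf_bounded)
        then have "ereal p0 < ereal p'" using ps(1) by (rule le_less_trans)
        then show False using r(3) by simp
      qed
      moreover have "\<exists>\<^sub>F h in at 0. s0 < q x h"
      proof (rule ccontr)
        assume "\<not> (\<exists>\<^sub>F h in at 0. s0 < q x h)"
        then have "\<forall>\<^sub>F h in at 0. ereal (q x h) \<le> ereal s0" by (simp add: not_frequently not_less)
        then have "?u \<le> ereal s0" by (rule Limsup_bounded)
        then have "ereal s' < ereal s0" using ps(3) by (rule less_le_trans[rotated])
        then show False using r(6) by simp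
      qed
      ultimately have "x \<in> E p0 s0" using x by (simp add: E_def)
      then show ?thesis using r by (force simp: N_def)
    qed
  qed
  ultimately show ?thesis by (rule negligible_subset)
qed

section \<open>Convolution with the weakly singular kernel\<close>

text \<open>The cut-off at zero puts the moving limit of integration into the kernel: up to the
  Gamma factor, left and right fractional integrals are integrals over the whole line against
  \<open>causal_kernel \<gamma> (x - t)\<close> and
  \<open>causal_kernel \<gamma> (t - x)\<close>.\<close>

definition causal_kernel :: "real \<Rightarrow> real \<Rightarrow> real" where
  "causal_kernel \<gamma> u = (if 0 \<le> u then u powr (\<gamma> - 1) else 0)"

lemma causal_kernel_nonneg: "0 \<le> causal_kernel \<gamma> u"
  by (simp add: causal_kernel_def)

lemma borel_measurable_causal_kernel [measurable]: "causal_kernel \<gamma> \<in> borel_measurable borel"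
  unfolding causal_kernel_def[abs_def] by measurable

lemma integrable_causal_kernel:
  assumes "0 < \<gamma>"
  shows "integrable lborel (\<lambda>u. causal_kernel \<gamma> u * indicator {..c} u)"
proof -
  have "((\<lambda>u. u powr (\<gamma> - 1)) has_integral (max 0 c powr (\<gamma> - 1 + 1) / (\<gamma> - 1 + 1))) {0..max 0 c}"
    using assms by (intro has_integral_powr_from_0) auto
  then have "(\<lambda>u. u powr (\<gamma> - 1)) absolutely_integrable_on {0..max 0 c}"
    by (intro nonnegative_absolutely_integrable_1) (auto simp: integrable_on_def)
  then have "integrable lborel (\<lambda>u. indicator {0..max 0 c} u *\<^sub>R u powr (\<gamma> - 1))"
    unfolding set_integrable_def by (subst (asm) integrable_completion) auto
  then show ?thesis
    by (rule Bochner_Integration.integrable_bound)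
      (auto simp: causal_kernel_def indicator_def)
qed

text \<open>Functions known only on \<open>{a..b}\<close> are extended by zero to Borel functions on
  the line, so that translation, reflection and Fubini for \<open>lborel\<close> apply. The price is
  a possible jump at \<open>a\<close> and \<open>b\<close>, harmless under the integral.\<close>

locale clipped_function =
  fixes a b :: real and h :: "real \<Rightarrow> real"
  assumes cont: "continuous_on {a..b} h"
begin

definition clip :: "real \<Rightarrow> real" where "clip t = indicat_real {a..b} t * h t"

lemma clip_measurable [measurable]: "clip \<in> borel_measurable borel"
  unfolding clip_def[abs_def] using borel_measurable_continuous_on_indicator[OF _ cont] by simp

lemma clip_eq_0: "t \<notin> {a..b} \<Longrightarrow> clip t = 0"
  by (simp add: clip_def)

lemma clip_bounded: obtains B where "0 \<le> B" "\<And>t. \<bar>clip t\<bar> \<le> B"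
proof -
  have "bounded (h ` {a..b})"
    using cont by (intro compact_imp_bounded compact_continuous_image) auto
  then obtain B where B: "\<forall>t\<in>{a..b}. \<bar>h t\<bar> \<le> B" by (auto simp: bounded_iff)
  have "\<bar>clip t\<bar> \<le> max 0 B" for t
    using B by (cases "t \<in> {a..b}") (auto simp: clip_def le_max_iff_disj)
  then show ?thesis by (intro that[of "max 0 B"]) auto
qed

lemma clip_isCont:
  assumes "t \<noteq> a" "t \<noteq> b"
  shows "isCont clip t"
proof (cases "t \<in> {a<..<b}")
  case True
  have "isCont h t"
    using True cont by (intro continuous_on_interior[of "{a..b}"]) auto
  moreover have "\<forall>\<^sub>F s in nhds t. clip s = h s"
    by (rule eventually_mono[OF eventually_nhds_in_open[of "{a<..<b}" t]])
      (use True in \<open>auto simp: clip_def\<close>)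
  ultimately show ?thesis by (simp add: isCont_cong)
next
  case False
  have "\<forall>\<^sub>F s in nhds t. clip s = 0"
    by (rule eventually_mono[OF eventually_nhds_in_open[of "- {a..b}" t]])
      (use False assms in \<open>auto simp: clip_def\<close>)
  then have "isCont clip t \<longleftrightarrow> isCont (\<lambda>_. 0 :: real) t" by (rule isCont_cong)
  then show ?thesis by simp
qed

lemma integrable_left:
  assumes "0 < \<gamma>"
  shows "integrable lborel (\<lambda>t. causal_kernel \<gamma> (x - t) * clip t)"
proof -
  obtain B where B: "0 \<le> B" "\<And>t. \<bar>clip t\<bar> \<le> B" using clip_bounded by blast
  have "integrable lborel (\<lambda>t. causal_kernel \<gamma> (x + (-1) * t) * indicator {..x - a} (x + (-1) * t))"
    by (rule lborel_integrable_real_affine[OF integrable_causal_kernel[OF assms]]) simp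
  then have "integrable lborel (\<lambda>t. B * (causal_kernel \<gamma> (x - t) * indicator {..x - a} (x - t)))"
    by simp
  then show ?thesis
  proof (rule Bochner_Integration.integrable_bound)
    show "AE t in lborel. norm (causal_kernel \<gamma> (x - t) * clip t)
        \<le> norm (B * (causal_kernel \<gamma> (x - t) * indicator {..x - a} (x - t)))"
    proof (rule AE_I2)
      fix t
      show "norm (causal_kernel \<gamma> (x - t) * clip t)
        \<le> norm (B * (causal_kernel \<gamma> (x - t) * indicator {..x - a} (x - t)))"
      proof (cases "t \<in> {a..b}")
        case True
        have "\<bar>clip t\<bar> * causal_kernel \<gamma> (x - t) \<le> B * causal_kernel \<gamma> (x - t)"
          using B(2) causal_kernel_nonneg by (intro mult_right_mono) auto
        then show ?thesis
          using True B(1) by (simp add: abs_mult causal_kernel_nonneg mult.commute)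
      qed (simp add: clip_eq_0)
    qed
  qed simp
qed

text \<open>The substitution \<open>u = x - t\<close> fixes the singularity and moves
  \<open>x\<close> into the bounded factor \<open>clip\<close>, which is continuous off two points;
  dominated convergence applies.\<close>

lemma continuous_left:
  assumes "0 < \<gamma>"
  shows "continuous_on UNIV (\<lambda>x. \<integral>t. causal_kernel \<gamma> (x - t) * clip t \<partial>lborel)"
proof -
  obtain B where B: "0 \<le> B" "\<And>t. \<bar>clip t\<bar> \<le> B" using clip_bounded by blast
  have shift: "(\<integral>t. causal_kernel \<gamma> (x - t) * clip t \<partial>lborel)
      = (\<integral>u. causal_kernel \<gamma> u * clip (x - u) \<partial>lborel)" for x
    using lborel_integral_real_affine[of "-1" "\<lambda>t. causal_kernel \<gamma> (x - t) * clip t" x] by simp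
  have "continuous_on UNIV (\<lambda>x. \<integral>u. causal_kernel \<gamma> u * clip (x - u) \<partial>lborel)"
    unfolding continuous_on_sequentially
  proof (intro allI impI ballI, elim conjE)
    fix X :: "nat \<Rightarrow> real" and x assume X: "X \<longlonglongrightarrow> x"
    \<comment> \<open>A bound \<open>C\<close> on the whole sequence gives one truncation
      \<open>{..C - a}\<close> of the kernel, hence one dominating function for all
      \<open>n\<close>.\<close>
    then obtain C where C: "\<And>n. \<bar>X n\<bar> \<le> C"
      using convergent_imp_Bseq[of X] by (auto simp: convergent_def Bseq_def)
    have "(\<lambda>n. \<integral>u. causal_kernel \<gamma> u * clip (X n - u) \<partial>lborel)
        \<longlonglongrightarrow> (\<integral>u. causal_kernel \<gamma> u * clip (x - u) \<partial>lborel)"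
    proof (rule integral_dominated_convergence)
      show "integrable lborel (\<lambda>u. B * (causal_kernel \<gamma> u * indicator {..C - a} u))"
        using integrable_causal_kernel[OF assms] by simp
      have "AE u in lborel. u \<notin> {x - a, x - b}"
        by (intro AE_not_in countable_imp_null_set_lborel) simp
      then show "AE u in lborel. (\<lambda>n. causal_kernel \<gamma> u * clip (X n - u)) \<longlonglongrightarrow> causal_kernel \<gamma> u * clip (x - u)"
      proof (rule AE_mp, intro AE_I2 impI)
        fix u assume "u \<notin> {x - a, x - b}"
        then have "isCont clip (x - u)" by (intro clip_isCont) auto
        moreover have "(\<lambda>n. X n - u) \<longlonglongrightarrow> x - u" by (intro tendsto_intros X)
        ultimately show "(\<lambda>n. causal_kernel \<gamma> u * clip (X n - u)) \<longlonglongrightarrow> causal_kernel \<gamma> u * clip (x - u)"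
          by (rule tendsto_mult[OF tendsto_const isCont_tendsto_compose])
      qed
      show "AE u in lborel. norm (causal_kernel \<gamma> u * clip (X n - u))
          \<le> B * (causal_kernel \<gamma> u * indicator {..C - a} u)" for n
      proof (rule AE_I2)
        fix u
        show "norm (causal_kernel \<gamma> u * clip (X n - u))
          \<le> B * (causal_kernel \<gamma> u * indicator {..C - a} u)"
        proof (cases "X n - u \<in> {a..b}")
          case True
          have "u \<le> C - a" using True C[of n] by auto
          moreover have "causal_kernel \<gamma> u * \<bar>clip (X n - u)\<bar> \<le> causal_kernel \<gamma> u * B"
            using B(2) causal_kernel_nonneg by (intro mult_left_mono) auto
          ultimately show ?thesis by (simp add: abs_mult causal_kernel_nonneg mult.commute)
        qed (simp add: clip_eq_0 B(1) causal_kernel_nonneg)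
      qed
    qed measurable
    then show "((\<lambda>x. \<integral>u. causal_kernel \<gamma> u * clip (x - u) \<partial>lborel) \<circ> X)
        \<longlonglongrightarrow> (\<integral>u. causal_kernel \<gamma> u * clip (x - u) \<partial>lborel)"
      by (simp add: o_def)
  qed
  then show ?thesis by (simp add: shift)
qed

text \<open>Reflection in the origin exchanges left and right integrals; the right-sided facts below
  are the left-sided ones for the reflected function on \<open>{- b..- a}\<close>.\<close>

lemma clipped_function_reflect: "clipped_function (- b) (- a) (\<lambda>t. h (- t))"
  by standard (rule continuous_on_compose2[OF cont], auto intro!: continuous_intros)

lemma clip_reflect: "clipped_function.clip (- b) (- a) (\<lambda>t. h (- t)) t = clip (- t)"
proof -
  interpret r: clipped_function "- b" "- a" "\<lambda>t. h (- t)" by (rule clipped_function_reflect)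
  show ?thesis by (auto simp: r.clip_def clip_def indicator_def)
qed

lemma integrable_right:
  assumes "0 < \<gamma>"
  shows "integrable lborel (\<lambda>t. causal_kernel \<gamma> (t - x) * clip t)"
proof -
  interpret r: clipped_function "- b" "- a" "\<lambda>t. h (- t)" by (rule clipped_function_reflect)
  show ?thesis
    using lborel_integrable_real_affine[OF r.integrable_left[OF assms, of "- x"], of "-1" 0]
    by (simp add: clip_reflect)
qed

lemma continuous_right:
  assumes "0 < \<gamma>"
  shows "continuous_on UNIV (\<lambda>x. \<integral>t. causal_kernel \<gamma> (t - x) * clip t \<partial>lborel)"
proof -
  interpret r: clipped_function "- b" "- a" "\<lambda>t. h (- t)" by (rule clipped_function_reflect)
  have "(\<integral>t. causal_kernel \<gamma> (t - x) * clip t \<partial>lborel)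
      = (\<integral>t. causal_kernel \<gamma> (- x - t) * r.clip t \<partial>lborel)" for x
    using lborel_integral_real_affine[of "-1" "\<lambda>t. causal_kernel \<gamma> (t - x) * clip t" 0]
    by (simp add: clip_reflect minus_diff_commute)
  moreover have "continuous_on UNIV (\<lambda>x. \<integral>t. causal_kernel \<gamma> (- x - t) * r.clip t \<partial>lborel)"
    by (rule continuous_on_compose2[OF r.continuous_left[OF assms], of UNIV uminus])
      (auto intro!: continuous_intros)
  ultimately show ?thesis by simp
qed

text \<open>Connects the defining integrals, taken for \<open>lebesgue\<close> up to
  \<open>x\<close>, with the convolution over \<open>lborel\<close>. Integrability is stated
  separately because the value of the integral does not record it.\<close>

lemma left_conv_eq:
  assumes "x \<in> {a..b}"
  shows "(LINT t:{a..x}|lebesgue. (x - t) powr (\<gamma> - 1) * h t)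
      = (\<integral>t. causal_kernel \<gamma> (x - t) * clip t \<partial>lborel)"
    and "0 < \<gamma> \<Longrightarrow> set_integrable lebesgue {a..x} (\<lambda>t. (x - t) powr (\<gamma> - 1) * h t)"
proof -
  have eq: "(\<lambda>t. indicator {a..x} t *\<^sub>R ((x - t) powr (\<gamma> - 1) * h t))
      = (\<lambda>t. causal_kernel \<gamma> (x - t) * clip t)"
    using assms by (auto simp: fun_eq_iff causal_kernel_def clip_def indicator_def)
  show "(LINT t:{a..x}|lebesgue. (x - t) powr (\<gamma> - 1) * h t)
      = (\<integral>t. causal_kernel \<gamma> (x - t) * clip t \<partial>lborel)"
    unfolding set_lebesgue_integral_def eq by (rule integral_completion) simp
  show "set_integrable lebesgue {a..x} (\<lambda>t. (x - t) powr (\<gamma> - 1) * h t)" if "0 < \<gamma>"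
    unfolding set_integrable_def eq using integrable_left[OF that]
    by (subst integrable_completion) auto
qed

lemma right_conv_eq:
  assumes "x \<in> {a..b}"
  shows "(LINT t:{x..b}|lebesgue. (t - x) powr (\<gamma> - 1) * h t)
      = (\<integral>t. causal_kernel \<gamma> (t - x) * clip t \<partial>lborel)"
    and "0 < \<gamma> \<Longrightarrow> set_integrable lebesgue {x..b} (\<lambda>t. (t - x) powr (\<gamma> - 1) * h t)"
proof -
  have eq: "(\<lambda>t. indicator {x..b} t *\<^sub>R ((t - x) powr (\<gamma> - 1) * h t))
      = (\<lambda>t. causal_kernel \<gamma> (t - x) * clip t)"
    using assms by (auto simp: fun_eq_iff causal_kernel_def clip_def indicator_def)
  show "(LINT t:{x..b}|lebesgue. (t - x) powr (\<gamma> - 1) * h t)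
      = (\<integral>t. causal_kernel \<gamma> (t - x) * clip t \<partial>lborel)"
    unfolding set_lebesgue_integral_def eq by (rule integral_completion) simp
  show "set_integrable lebesgue {x..b} (\<lambda>t. (t - x) powr (\<gamma> - 1) * h t)" if "0 < \<gamma>"
    unfolding set_integrable_def eq using integrable_right[OF that]
    by (subst integrable_completion) auto
qed

lemma integrable_clip: "integrable lborel clip"
  using borel_integrable_atLeastAtMost'[OF cont]
  by (simp add: set_integrable_def clip_def[abs_def])

lemma integral_clip:
  "(LINT t:{a..b}|lebesgue. h t) = (\<integral>t. clip t \<partial>lborel)"
  "(LINT t:{a..b}|lebesgue. h t) = integral {a..b} h"
proof -
  show "(LINT t:{a..b}|lebesgue. h t) = (\<integral>t. clip t \<partial>lborel)"
    unfolding set_lebesgue_integral_def clip_def[abs_def]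
    using integral_completion[of clip lborel] clip_measurable by (simp add: clip_def[abs_def])
  show "(LINT t:{a..b}|lebesgue. h t) = integral {a..b} h"
    using integrable_clip
    by (intro set_lebesgue_integral_eq_integral)
      (simp add: set_integrable_def clip_def[abs_def] integrable_completion)
qed

end

lemma set_lebesgue_integral_eq_HK:
  fixes h :: "real \<Rightarrow> real"
  assumes "continuous_on {a..b} h"
  shows "(LINT t:{a..b}|lebesgue. h t) = integral {a..b} h"
  using clipped_function.integral_clip(2) assms by (simp add: clipped_function_def)

lemma continuous_on_left_conv:
  fixes h :: "real \<Rightarrow> real"
  assumes "continuous_on {a..b} h" "0 < \<gamma>"
  shows "continuous_on {a..b} (\<lambda>x. LINT t:{a..x}|lebesgue. (x - t) powr (\<gamma> - 1) * h t)"
proof -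
  interpret clipped_function a b h by standard (rule assms)
  show ?thesis
    by (subst continuous_on_cong[OF refl left_conv_eq(1)], assumption,
        rule continuous_on_subset[OF continuous_left[OF assms(2)] subset_UNIV])
qed

lemma continuous_on_right_conv:
  fixes h :: "real \<Rightarrow> real"
  assumes "continuous_on {a..b} h" "0 < \<gamma>"
  shows "continuous_on {a..b} (\<lambda>x. LINT t:{x..b}|lebesgue. (t - x) powr (\<gamma> - 1) * h t)"
proof -
  interpret clipped_function a b h by standard (rule assms)
  show ?thesis
    by (subst continuous_on_cong[OF refl right_conv_eq(1)], assumption,
        rule continuous_on_subset[OF continuous_right[OF assms(2)] subset_UNIV])
qed

text \<open>Fractional integration by parts, without the Gamma factor. Both sides are iterated
  integrals over the triangle \<open>a \<le> t \<le> x \<le> b\<close>; the cut-off in the kernel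
  encodes \<open>t \<le> x\<close>, so Fubini is applied on the whole plane.\<close>

lemma integral_left_conv_swap:
  fixes f h :: "real \<Rightarrow> real"
  assumes f: "continuous_on {a..b} f" and h: "continuous_on {a..b} h" and "0 < \<gamma>"
  shows "(LINT x:{a..b}|lebesgue. f x * (LINT t:{a..x}|lebesgue. (x - t) powr (\<gamma> - 1) * h t))
       = (LINT t:{a..b}|lebesgue. (LINT x:{t..b}|lebesgue. (x - t) powr (\<gamma> - 1) * f x) * h t)"
proof -
  interpret f: clipped_function a b f by standard (rule f)
  interpret h: clipped_function a b h by standard (rule h)
  interpret ah: clipped_function a b "\<lambda>t. \<bar>h t\<bar>" by standard (intro continuous_intros h)
  let ?k = "causal_kernel \<gamma>"
  let ?K = "\<lambda>(x, t). f.clip x * (?k (x - t) * h.clip t)"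
  have "integrable (lborel \<Otimes>\<^sub>M lborel) ?K"
  proof (rule lborel_pair.Fubini_integrable)
    show "?K \<in> borel_measurable (lborel \<Otimes>\<^sub>M lborel)" by measurable
    show "AE x in lborel. integrable lborel (\<lambda>t. ?K (x, t))"
      using h.integrable_left[OF \<open>0 < \<gamma>\<close>] by simp
    \<comment> \<open>The absolute value of the integrand has the same shape with
      \<open>\<bar>h\<bar>\<close> for \<open>h\<close>; its inner integral is therefore continuous
      in \<open>x\<close>, and the outer one runs over a compact interval.\<close>
    have "(\<integral>t. norm (?K (x, t)) \<partial>lborel) = \<bar>f.clip x\<bar> * (\<integral>t. ?k (x - t) * ah.clip t \<partial>lborel)" for x
      by (simp add: abs_mult causal_kernel_nonneg h.clip_def ah.clip_def)
    moreover have "integrable lborel (\<lambda>x. \<bar>f.clip x\<bar> * (\<integral>t. ?k (x - t) * ah.clip t \<partial>lborel))"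
    proof -
      have "continuous_on {a..b} (\<lambda>x. \<bar>f x\<bar> * (\<integral>t. ?k (x - t) * ah.clip t \<partial>lborel))"
        by (intro continuous_intros f continuous_on_subset[OF ah.continuous_left[OF \<open>0 < \<gamma>\<close>]]) simp
      then have "set_integrable lborel {a..b} (\<lambda>x. \<bar>f x\<bar> * (\<integral>t. ?k (x - t) * ah.clip t \<partial>lborel))"
        by (rule borel_integrable_atLeastAtMost')
      then show ?thesis by (simp add: set_integrable_def f.clip_def abs_mult mult.assoc)
    qed
    ultimately show "integrable lborel (\<lambda>x. \<integral>t. norm (?K (x, t)) \<partial>lborel)" by simp
  qed
  then have "(\<integral>t. (\<integral>x. f.clip x * (?k (x - t) * h.clip t) \<partial>lborel) \<partial>lborel)
      = (\<integral>x. (\<integral>t. f.clip x * (?k (x - t) * h.clip t) \<partial>lborel) \<partial>lborel)"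
    by (rule lborel_pair.Fubini_integral)
  moreover have "(\<lambda>x. f.clip x * (?k (x - t) * h.clip t)) = (\<lambda>x. (?k (x - t) * f.clip x) * h.clip t)" for t
    by (simp add: fun_eq_iff mult_ac)
  ultimately have main: "(\<integral>x. f.clip x * (\<integral>t. ?k (x - t) * h.clip t \<partial>lborel) \<partial>lborel)
      = (\<integral>t. (\<integral>x. ?k (x - t) * f.clip x \<partial>lborel) * h.clip t \<partial>lborel)"
    by simp
  interpret l: clipped_function a b "\<lambda>x. f x * (LINT t:{a..x}|lebesgue. (x - t) powr (\<gamma> - 1) * h t)"
    by standard (intro continuous_on_mult f continuous_on_left_conv h \<open>0 < \<gamma>\<close>)
  interpret r: clipped_function a b "\<lambda>t. (LINT x:{t..b}|lebesgue. (x - t) powr (\<gamma> - 1) * f x) * h t"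
    by standard (intro continuous_on_mult f continuous_on_right_conv h \<open>0 < \<gamma>\<close>)
  have "l.clip = (\<lambda>x. f.clip x * (\<integral>t. ?k (x - t) * h.clip t \<partial>lborel))"
  proof
    show "l.clip x = f.clip x * (\<integral>t. ?k (x - t) * h.clip t \<partial>lborel)" for x
      by (cases "x \<in> {a..b}") (simp_all add: l.clip_def f.clip_def h.left_conv_eq)
  qed
  moreover have "r.clip = (\<lambda>t. (\<integral>x. ?k (x - t) * f.clip x \<partial>lborel) * h.clip t)"
  proof
    show "r.clip t = (\<integral>x. ?k (x - t) * f.clip x \<partial>lborel) * h.clip t" for t
      by (cases "t \<in> {a..b}") (simp_all add: r.clip_def h.clip_def f.right_conv_eq)
  qed
  ultimately show ?thesis
    unfolding l.integral_clip(1) r.integral_clip(1) using main by simp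
qed

section \<open>The admissible class and its variations\<close>

text \<open>These functions serve as variations: their Caputo derivative is the left integral of
  order \<open>1 - \<alpha>\<close> of a continuous function, the form to which integration by parts
  applies.\<close>

lemma frac_class_C1:
  assumes \<alpha>: "\<alpha> < 1" and "0 < \<beta>"
    and \<eta>: "\<And>x. (\<eta> has_real_derivative \<eta>' x) (at x)" and \<eta>': "continuous_on UNIV \<eta>'"
  shows "\<eta> \<in> frac_class a b \<alpha> \<beta>"
    and "caputo_left a \<alpha> \<eta> = rl_int_left a (1 - \<alpha>) \<eta>'"
proof -
  have d: "deriv \<eta> = \<eta>'" using \<eta> DERIV_imp_deriv by blast
  have \<eta>c: "continuous_on {a..b} \<eta>"
    by (intro DERIV_continuous_on[of _ _ \<eta>'] has_field_derivative_at_within[OF \<eta>])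
  have \<eta>'c: "continuous_on {a..b} \<eta>'" by (rule continuous_on_subset[OF \<eta>' subset_UNIV])
  show cap: "caputo_left a \<alpha> \<eta> = rl_int_left a (1 - \<alpha>) \<eta>'"
    by (simp add: fun_eq_iff caputo_left_def rl_int_left_def d)
  have "bounded (\<eta>' ` {a..b})"
    using \<eta>'c by (intro compact_imp_bounded compact_continuous_image) auto
  then obtain B where B: "\<And>t. t \<in> {a..b} \<Longrightarrow> \<bar>\<eta>' t\<bar> \<le> B"
    unfolding bounded_iff by (metis imageI real_norm_def)
  have ac: "absolutely_continuous_fun_on {a..b} \<eta>"
  proof (rule Lipschitz_imp_absolutely_continuous)
    fix x y assume "x \<in> {a..b}" "y \<in> {a..b}"
    then show "\<bar>\<eta> x - \<eta> y\<bar> \<le> B * \<bar>x - y\<bar>"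
      using field_differentiable_bound[of "{a..b}" \<eta> \<eta>' B y x] B
        has_field_derivative_at_within[OF \<eta>] by (simp add: abs_minus_commute)
  qed
  interpret h: clipped_function a b \<eta> by standard (rule \<eta>c)
  interpret h': clipped_function a b \<eta>' by standard (rule \<eta>'c)
  have "caputo_left_exists a \<alpha> \<eta> x" if "x \<in> {a..b}" for x
    using h'.left_conv_eq(2)[OF that, of "1 - \<alpha>"] \<alpha> by (simp add: caputo_left_exists_def d)
  moreover have "continuous_on {a..b} (caputo_left a \<alpha> \<eta>)"
    using continuous_on_left_conv[OF \<eta>'c, of "1 - \<alpha>"] \<alpha>
    unfolding cap rl_int_left_def by (intro continuous_on_mult continuous_on_const) simp
  moreover have "continuous_on {a..b} (rl_int_left a \<beta> \<eta>)"
    unfolding rl_int_left_def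
    by (intro continuous_on_mult continuous_on_const continuous_on_left_conv[OF \<eta>c \<open>0 < \<beta>\<close>])
  ultimately show "\<eta> \<in> frac_class a b \<alpha> \<beta>"
    using ac h.left_conv_eq(2) \<open>0 < \<beta>\<close> by (auto simp: frac_class_def rl_int_left_exists_def)
qed

lemma frac_class_continuous_on:
  assumes "y \<in> frac_class a b \<alpha> \<beta>"
  shows "continuous_on {a..b} y" "continuous_on {a..b} (caputo_left a \<alpha> y)"
    "continuous_on {a..b} (rl_int_left a \<beta> y)"
  using assms absolutely_continuous_imp_continuous by (auto simp: frac_class_def)

text \<open>Outside the null set \<open>N\<close> the derivative of
  \<open>y + \<epsilon> \<eta>\<close> is the sum of the derivatives. On \<open>N\<close> nothing is
  known about \<open>deriv y\<close>, but neither integrability nor the value of the Caputo integral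
  sees a null set.\<close>

lemma frac_class_perturb:
  fixes y \<eta> \<eta>' :: "real \<Rightarrow> real" and \<epsilon> :: real
  assumes y: "y \<in> frac_class a b \<alpha> \<beta>" and \<alpha>: "\<alpha> < 1" and "0 < \<beta>"
    and \<eta>: "\<And>x. (\<eta> has_real_derivative \<eta>' x) (at x)" and \<eta>': "continuous_on UNIV \<eta>'"
  defines "u \<equiv> (\<lambda>x. y x + \<epsilon> * \<eta> x)"
  shows "u \<in> frac_class a b \<alpha> \<beta>"
    and "x \<in> {a..b} \<Longrightarrow> caputo_left a \<alpha> u x = caputo_left a \<alpha> y x + \<epsilon> * caputo_left a \<alpha> \<eta> x"
    and "x \<in> {a..b} \<Longrightarrow> rl_int_left a \<beta> u x = rl_int_left a \<beta> y x + \<epsilon> * rl_int_left a \<beta> \<eta> x"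
proof -
  have \<eta>F: "\<eta> \<in> frac_class a b \<alpha> \<beta>" by (rule frac_class_C1(1)[OF \<alpha> \<open>0 < \<beta>\<close> \<eta> \<eta>'])
  have acy: "absolutely_continuous_fun_on {a..b} y" using y by (simp add: frac_class_def)
  have acu: "absolutely_continuous_fun_on {a..b} u"
    unfolding u_def using acy \<eta>F by (intro absolutely_continuous_fun_on_lincomb) (auto simp: frac_class_def)
  \<comment> \<open>Differentiability almost everywhere speaks of the open interval, so the
    endpoints are added.\<close>
  define N where "N = {x \<in> {a<..<b}. \<not> (\<exists>D. (y has_real_derivative D) (at x))} \<union> {a, b}"
  have N: "negligible N"
    unfolding N_def using absolutely_continuous_imp_differentiable_AE[OF acy] by auto
  have du: "deriv u t = deriv y t + \<epsilon> * deriv \<eta> t" if "t \<in> {a..b} - N" for t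
  proof -
    have "t \<in> {a<..<b}" "\<exists>D. (y has_real_derivative D) (at t)"
      using that by (auto simp: N_def order.strict_iff_order)
    then obtain D where D: "(y has_real_derivative D) (at t)" by blast
    have "(u has_real_derivative D + \<epsilon> * \<eta>' t) (at t)"
      unfolding u_def by (intro DERIV_add D DERIV_cmult \<eta>)
    then show ?thesis using DERIV_imp_deriv[OF D] DERIV_imp_deriv[OF \<eta>[of t]] by (simp add: DERIV_imp_deriv)
  qed
  have cap: "caputo_left_exists a \<alpha> u x"
    "caputo_left a \<alpha> u x = caputo_left a \<alpha> y x + \<epsilon> * caputo_left a \<alpha> \<eta> x" if x: "x \<in> {a..b}" for x
  proof -
    let ?k = "\<lambda>f t. (x - t) powr (- \<alpha>) * f t"
    have i: "?k (deriv y) absolutely_integrable_on {a..x}" "?k (deriv \<eta>) absolutely_integrable_on {a..x}"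
      using y \<eta>F x by (auto simp: frac_class_def caputo_left_exists_def)
    have s: "(\<lambda>t. ?k (deriv y) t + \<epsilon> * ?k (deriv \<eta>) t) absolutely_integrable_on {a..x}"
      by (intro set_integral_add set_integrable_mult_right i)
    have eq: "?k (deriv u) t = ?k (deriv y) t + \<epsilon> * ?k (deriv \<eta>) t" if "t \<in> {a..x} - N" for t
      using du[of t] that x by (simp add: algebra_simps)
    have iu: "?k (deriv u) absolutely_integrable_on {a..x}"
      by (rule absolutely_integrable_spike[OF s N eq])
    show "caputo_left_exists a \<alpha> u x" using iu by (simp add: caputo_left_exists_def)
    have "(LINT t:{a..x}|lebesgue. ?k (deriv u) t) = (LINT t:{a..x}|lebesgue. ?k (deriv y) t + \<epsilon> * ?k (deriv \<eta>) t)"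
      unfolding set_lebesgue_integral_eq_integral(2)[OF iu] set_lebesgue_integral_eq_integral(2)[OF s]
      by (rule integral_spike[OF N eq[symmetric]]) 
    also have "\<dots> = (LINT t:{a..x}|lebesgue. ?k (deriv y) t) + \<epsilon> * (LINT t:{a..x}|lebesgue. ?k (deriv \<eta>) t)"
      using i by simp
    finally show "caputo_left a \<alpha> u x = caputo_left a \<alpha> y x + \<epsilon> * caputo_left a \<alpha> \<eta> x"
      by (simp add: caputo_left_def algebra_simps)
  qed
  have rl: "rl_int_left_exists a \<beta> u x"
    "rl_int_left a \<beta> u x = rl_int_left a \<beta> y x + \<epsilon> * rl_int_left a \<beta> \<eta> x" if x: "x \<in> {a..b}" for x
  proof -
    let ?k = "\<lambda>f t. (x - t) powr (\<beta> - 1) * f t"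
    have i: "set_integrable lebesgue {a..x} (?k y)" "set_integrable lebesgue {a..x} (?k \<eta>)"
      using y \<eta>F x by (auto simp: frac_class_def rl_int_left_exists_def)
    have eq: "?k u t = ?k y t + \<epsilon> * ?k \<eta> t" for t by (simp add: u_def algebra_simps)
    show "rl_int_left_exists a \<beta> u x"
      unfolding rl_int_left_exists_def eq by (intro set_integral_add set_integrable_mult_right i)
    show "rl_int_left a \<beta> u x = rl_int_left a \<beta> y x + \<epsilon> * rl_int_left a \<beta> \<eta> x"
      unfolding rl_int_left_def eq using i
      by (simp add: algebra_simps)
  qed
  have "continuous_on {a..b} (caputo_left a \<alpha> u)"
    by (subst continuous_on_cong[OF refl cap(2)], assumption)
      (intro continuous_intros frac_class_continuous_on[OF y] frac_class_continuous_on[OF \<eta>F])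
  moreover have "continuous_on {a..b} (rl_int_left a \<beta> u)"
    by (subst continuous_on_cong[OF refl rl(2)], assumption)
      (intro continuous_intros frac_class_continuous_on[OF y] frac_class_continuous_on[OF \<eta>F])
  ultimately show "u \<in> frac_class a b \<alpha> \<beta>"
    using acu cap(1) rl(1) by (simp add: frac_class_def)
  show "x \<in> {a..b} \<Longrightarrow> caputo_left a \<alpha> u x = caputo_left a \<alpha> y x + \<epsilon> * caputo_left a \<alpha> \<eta> x"
    and "x \<in> {a..b} \<Longrightarrow> rl_int_left a \<beta> u x = rl_int_left a \<beta> y x + \<epsilon> * rl_int_left a \<beta> \<eta> x"
    by (fact cap(2), fact rl(2))
qed

section \<open>Integrals depending on a parameter\<close>

text \<open>The curve keeps its first coordinate fixed and thus stays in
  \<open>X \<times> UNIV\<close>, so a derivative within that set suffices even when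
  \<open>x\<close> is a boundary point of \<open>X\<close>.\<close>

lemma C1_chain:
  fixes F :: "real \<times> 'b::real_normed_vector \<Rightarrow> real"
  assumes F: "\<forall>p\<in>X \<times> UNIV. (F has_derivative blinfun_apply (F' p)) (at p within X \<times> UNIV)"
    and "x \<in> X" and c: "(c has_vector_derivative c') (at e)"
  shows "((\<lambda>e. F (x, c e)) has_real_derivative F' (x, c e) (0, c')) (at e)"
proof -
  have "((\<lambda>e. (x, c e)) has_derivative (\<lambda>h. (0, h *\<^sub>R c'))) (at e)"
    using c by (auto simp: has_vector_derivative_def intro!: has_derivative_Pair)
  then have "((\<lambda>e. F (x, c e)) has_derivative (\<lambda>h. F' (x, c e) (0, h *\<^sub>R c'))) (at e)"
    by (rule has_derivative_in_compose2[OF bspec[OF F], rotated 3]) (use \<open>x \<in> X\<close> in auto)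
  moreover have "F' (x, c e) (0, h *\<^sub>R c') = F' (x, c e) (0, c') * h" for h
    using blinfun.scaleR_right[of "F' (x, c e)" h "(0, c')"] by (simp add: mult.commute)
  ultimately show ?thesis by (simp add: has_field_derivative_def)
qed

text \<open>The substitution \<open>t = a + s * (x - a)\<close> gives an integral over the fixed
  interval from 0 to 1, in which \<open>x\<close> is a parameter just like \<open>e\<close>.\<close>

lemma continuous_on_integral_upper:
  fixes g :: "real \<Rightarrow> real \<Rightarrow> real"
  assumes g: "continuous_on (U \<times> {a..b}) (\<lambda>(e, t). g e t)"
  shows "continuous_on (U \<times> {a..b}) (\<lambda>(e, x). integral {a..x} (g e))"
proof -
  have "continuous_on ((U \<times> {a..b}) \<times> cbox 0 1)
      (\<lambda>(p, s). (snd p - a) *\<^sub>R g (fst p) (a + s * (snd p - a)))"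
  proof -
    have sub: "a + s * (x - a) \<in> {a..b}" if "x \<in> {a..b}" "s \<in> cbox 0 1" for x s
    proof -
      have "s * (x - a) \<le> 1 * (x - a)" using that by (intro mult_right_mono) auto
      then show ?thesis using that by auto
    qed
    have "continuous_on ((U \<times> {a..b}) \<times> cbox 0 1)
        (\<lambda>q. (\<lambda>(e, t). g e t) (fst (fst q), a + snd q * (snd (fst q) - a)))"
    proof (rule continuous_on_compose2[OF g])
      show "continuous_on ((U \<times> {a..b}) \<times> cbox 0 1)
          (\<lambda>q :: (real \<times> real) \<times> real. (fst (fst q), a + snd q * (snd (fst q) - a)))"
        by (intro continuous_intros)
      show "(\<lambda>q. (fst (fst q), a + snd q * (snd (fst q) - a))) ` ((U \<times> {a..b}) \<times> cbox 0 1) \<subseteq> U \<times> {a..b}"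
        using sub by (auto simp del: cbox_interval box_real atLeastAtMost_iff)
    qed
    then show ?thesis by (auto simp: case_prod_unfold intro!: continuous_intros)
  qed
  then have cont: "continuous_on (U \<times> {a..b})
      (\<lambda>p. integral (cbox 0 1) (\<lambda>s. (snd p - a) *\<^sub>R g (fst p) (a + s * (snd p - a))))"
    by (rule integral_continuous_on_param)
  have eq: "integral (cbox 0 1) (\<lambda>s. (x - a) *\<^sub>R g e (a + s * (x - a))) = integral {a..x} (g e)"
    if e: "e \<in> U" and x: "x \<in> {a..b}" for e x
  proof -
    have "continuous_on {a..b} (\<lambda>t. (\<lambda>(e, t). g e t) (e, t))"
      by (rule continuous_on_compose2[OF g]) (use e in \<open>auto intro!: continuous_intros\<close>)
    then have ge: "continuous_on {a..x} (g e)" using x by (simp add: continuous_on_subset)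
    have sub: "(\<lambda>s. a + s * (x - a)) ` {0..1} \<subseteq> {a..x}"
      using x mult_right_mono[of _ 1 "x - a"] by force
    have "((\<lambda>s. (x - a) *\<^sub>R g e (a + s * (x - a))) has_integral
        integral {a + 0 * (x - a)..a + 1 * (x - a)} (g e)) {0..1}"
      by (rule has_integral_substitution[OF _ _ sub ge])
        (use x in \<open>auto intro!: derivative_eq_intros\<close>)
    from integral_unique[OF this] show ?thesis by simp
  qed
  show ?thesis by (rule continuous_on_eq[OF cont]) (use eq in auto)
qed

text \<open>Made to be applied twice: with \<open>l\<close> to differentiate \<open>z\<close>, and
  with \<open>L\<close>, where \<open>z\<close> is part of the curve. The joint continuity of value
  and derivative is what the second application asks of its curve.\<close>

lemma C1_parametric_integral:
  fixes F :: "real \<times> 'b::real_normed_vector \<Rightarrow> real"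
  assumes F: "\<forall>p\<in>{a..b} \<times> UNIV. (F has_derivative blinfun_apply (F' p)) (at p within {a..b} \<times> UNIV)"
    and F': "continuous_on ({a..b} \<times> UNIV) F'"
    and c: "\<And>e t. t \<in> {a..b} \<Longrightarrow> ((\<lambda>e. c e t) has_vector_derivative c' e t) (at e)"
    and cc: "continuous_on (UNIV \<times> {a..b}) (\<lambda>(e, t). c e t)"
    and cc': "continuous_on (UNIV \<times> {a..b}) (\<lambda>(e, t). c' e t)"
  shows "x \<in> {a..b} \<Longrightarrow> ((\<lambda>e. integral {a..x} (\<lambda>t. F (t, c e t))) has_real_derivative
        integral {a..x} (\<lambda>t. F' (t, c e t) (0, c' e t))) (at e)"
    and "continuous_on (UNIV \<times> {a..b}) (\<lambda>(e, x). integral {a..x} (\<lambda>t. F (t, c e t)))"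
    and "continuous_on (UNIV \<times> {a..b}) (\<lambda>(e, x). integral {a..x} (\<lambda>t. F' (t, c e t) (0, c' e t)))"
proof -
  have Fc: "continuous_on ({a..b} \<times> UNIV) F" by (rule has_derivative_continuous_on[OF bspec[OF F]])
  have arg: "continuous_on (UNIV \<times> {a..b}) (\<lambda>q :: real \<times> real. (snd q, c (fst q) (snd q)))"
    using cc by (intro continuous_intros) (simp add: case_prod_unfold)
  have im: "(\<lambda>q :: real \<times> real. (snd q, c (fst q) (snd q))) ` (UNIV \<times> {a..b}) \<subseteq> {a..b} \<times> UNIV"
    by auto
  have 1: "continuous_on (UNIV \<times> {a..b}) (\<lambda>(e, t). F (t, c e t))"
    using continuous_on_compose2[OF Fc arg im] by (simp add: case_prod_unfold)
  have "continuous_on (UNIV \<times> {a..b}) (\<lambda>q :: real \<times> real. F' (snd q, c (fst q) (snd q)))"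
    using continuous_on_compose2[OF F' arg im] by simp
  then have 2: "continuous_on (UNIV \<times> {a..b}) (\<lambda>(e, t). F' (t, c e t) (0, c' e t))"
    using cc' by (auto simp: case_prod_unfold intro!: continuous_intros)
  show "continuous_on (UNIV \<times> {a..b}) (\<lambda>(e, x). integral {a..x} (\<lambda>t. F (t, c e t)))"
    by (rule continuous_on_integral_upper[OF 1])
  show "continuous_on (UNIV \<times> {a..b}) (\<lambda>(e, x). integral {a..x} (\<lambda>t. F' (t, c e t) (0, c' e t)))"
    by (rule continuous_on_integral_upper[OF 2])
  show "((\<lambda>e. integral {a..x} (\<lambda>t. F (t, c e t))) has_real_derivative
        integral {a..x} (\<lambda>t. F' (t, c e t) (0, c' e t))) (at e)" if x: "x \<in> {a..b}"
  proof -
    have "continuous_on {a..x} (\<lambda>t. F (t, c e t))" for e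
    proof -
      have "continuous_on {a..x} (Pair e)" by (intro continuous_intros)
      moreover have "Pair e ` {a..x} \<subseteq> UNIV \<times> {a..b}" using x by auto
      ultimately show ?thesis using continuous_on_compose2[OF 1, of "{a..x}" "Pair e"] by simp
    qed
    then have int: "(\<lambda>t. F (t, c e t)) integrable_on cbox a x" for e
      by (simp add: integrable_continuous_real)
    have "((\<lambda>e. integral (cbox a x) (\<lambda>t. F (t, c e t))) has_real_derivative
        integral (cbox a x) (\<lambda>t. F' (t, c e t) (0, c' e t))) (at e)"
    proof (rule leibniz_rule_field_derivative[OF _ int])
      show "((\<lambda>e. F (t, c e t)) has_real_derivative F' (t, c e t) (0, c' e t)) (at e)"
        if "t \<in> cbox a x" for e t
      proof -
        have "t \<in> {a..b}" using that x by auto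
        then show ?thesis using C1_chain[OF F _ c] by blast
      qed
      show "continuous_on (UNIV \<times> cbox a x) (\<lambda>(e, t). F' (t, c e t) (0, c' e t))"
        using x by (intro continuous_on_subset[OF 2]) auto
    qed auto
    then show ?thesis by simp
  qed
qed

section \<open>The lemma of du Bois-Reymond\<close>

lemma continuous_real_antiderivative:
  fixes g :: "real \<Rightarrow> real"
  assumes "continuous_on UNIV g"
  obtains G where "\<And>x. (G has_real_derivative g x) (at x)"
proof (rule that)
  fix x :: real
  \<comment> \<open>Both 0 and \<open>x\<close> lie in the interior of \<open>{A..B}\<close>, so the
    derivative within the interval is two-sided at \<open>x\<close>.\<close>
  define A B where "A = min 0 x - 1" and "B = max 0 x + 1"
  have "((\<lambda>u. LBINT y=ereal 0..ereal u. g y) has_vector_derivative g x) (at x within {A..B})"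
    using continuous_on_subset[OF assms]
    by (intro interval_integral_FTC2) (auto simp: A_def B_def)
  moreover have "at x within {A..B} = at x"
    by (rule at_within_interior) (auto simp: A_def B_def)
  ultimately show "((\<lambda>u. LBINT y=ereal 0..ereal u. g y) has_real_derivative g x) (at x)"
    by (simp add: has_real_derivative_iff_has_vector_derivative)
qed

text \<open>The test functions are free at both ends, so no additive constant remains: the constant
  one forces \<open>\<Psi> T = 0\<close>, and one with derivative \<open>D = B - \<Psi>\<close> on
  \<open>{a..T}\<close> reduces the hypothesis to a vanishing integral of the square of
  \<open>D\<close>.\<close>

lemma du_Bois_Reymond:
  fixes \<psi> B :: "real \<Rightarrow> real"
  assumes "a < T" and \<psi>: "continuous_on {a..T} \<psi>" and B: "continuous_on {a..T} B"
    and zero: "\<And>\<eta> \<eta>'. (\<And>x. (\<eta> has_real_derivative \<eta>' x) (at x)) \<Longrightarrow> continuous_on UNIV \<eta>' \<Longrightarrow>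
      integral {a..T} (\<lambda>x. \<psi> x * \<eta> x + B x * \<eta>' x) = 0"
    and x: "x \<in> {a..T}"
  shows "B x = integral {a..x} \<psi>"
proof -
  define \<Psi> where "\<Psi> x = integral {a..x} \<psi>" for x
  have d\<Psi>: "(\<Psi> has_real_derivative \<psi> x) (at x within {a..T})" if "x \<in> {a..T}" for x
    unfolding \<Psi>_def[abs_def] by (rule integral_has_real_derivative[OF \<psi> that])
  have \<Psi>c: "continuous_on {a..T} \<Psi>" by (rule DERIV_continuous_on[OF d\<Psi>])
  have \<Psi>a: "\<Psi> a = 0" by (simp add: \<Psi>_def)
  have \<Psi>T: "\<Psi> T = 0"
    using zero[of "\<lambda>_. 1" "\<lambda>_. 0"] by (simp add: \<Psi>_def)
  define D where "D x = B x - \<Psi> x" for x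
  have Dc: "continuous_on {a..T} D" unfolding D_def by (intro continuous_intros B \<Psi>c)
  \<comment> \<open>Clamping the argument to \<open>{a..T}\<close> extends \<open>D\<close>
    continuously to the line, as the test functions must be C1 everywhere.\<close>
  define \<eta>' where "\<eta>' x = D (max a (min T x))" for x
  have \<eta>'c: "continuous_on UNIV \<eta>'"
    unfolding \<eta>'_def
    by (rule continuous_on_compose2[OF Dc]) (use \<open>a < T\<close> in \<open>auto intro!: continuous_intros\<close>)
  obtain \<eta> where \<eta>: "\<And>x. (\<eta> has_real_derivative \<eta>' x) (at x)"
    using continuous_real_antiderivative[OF \<eta>'c] by blast
  have \<eta>c: "continuous_on {a..T} \<eta>"
    by (intro DERIV_continuous_on[of _ _ \<eta>'] has_field_derivative_at_within[OF \<eta>])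
  have \<eta>'T: "continuous_on {a..T} \<eta>'" by (rule continuous_on_subset[OF \<eta>'c subset_UNIV])
  have "((\<lambda>x. \<Psi> x * \<eta>' x + \<psi> x * \<eta> x) has_integral \<Psi> T * \<eta> T - \<Psi> a * \<eta> a) {a..T}"
    using \<open>a < T\<close>
    by (intro fundamental_theorem_of_calculus)
      (auto simp flip: has_real_derivative_iff_has_vector_derivative
        intro!: DERIV_mult' d\<Psi> has_field_derivative_at_within[OF \<eta>])
  then have parts: "integral {a..T} (\<lambda>x. \<Psi> x * \<eta>' x + \<psi> x * \<eta> x) = 0"
    by (simp add: integral_unique \<Psi>a \<Psi>T)
  have "integral {a..T} (\<lambda>x. \<psi> x * \<eta> x + B x * \<eta>' x) - integral {a..T} (\<lambda>x. \<Psi> x * \<eta>' x + \<psi> x * \<eta> x)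
      = integral {a..T} (\<lambda>x. \<psi> x * \<eta> x + B x * \<eta>' x - (\<Psi> x * \<eta>' x + \<psi> x * \<eta> x))"
    by (intro integral_diff[symmetric] integrable_continuous_real continuous_intros \<psi> B \<Psi>c \<eta>c \<eta>'T)
  also have "\<dots> = integral {a..T} (\<lambda>x. D x * D x)"
    by (rule integral_cong) (auto simp: D_def \<eta>'_def algebra_simps)
  finally have "integral {a..T} (\<lambda>x. D x * D x) = 0"
    using zero[OF \<eta> \<eta>'c] parts by simp
  then have "D x * D x = 0"
    using integral_eq_0_iff[OF continuous_on_mult[OF Dc Dc] \<open>a < T\<close>] x by simp
  then show ?thesis by (simp add: D_def \<Psi>_def)
qed

section \<open>Partial derivatives and the first variation\<close>

text \<open>The direction has 0 in its first slot because \<open>x\<close> is not varied. The other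
  variables range over the whole space, so the two-sided \<open>deriv\<close> in the partials agrees
  with the derivative within the set.\<close>

lemma C1_partials_L:
  assumes L: "\<forall>p\<in>X \<times> UNIV. (L has_derivative blinfun_apply (L' p)) (at p within X \<times> UNIV)"
    and "x \<in> X"
  shows "L' (x, y, v, w, z) (0, q1, q2, q3, q4) = L_dy L (x, y, v, w, z) * q1
     + L_dv L (x, y, v, w, z) * q2 + L_dw L (x, y, v, w, z) * q3 + L_dz L (x, y, v, w, z) * q4"
proof -
  let ?D = "L' (x, y, v, w, z)"
  note chain = C1_chain[OF L \<open>x \<in> X\<close>]
  have "L_dy L (x, y, v, w, z) = ?D (0, 1, 0, 0, 0)"
    unfolding L_dy_def prod.case
    by (intro DERIV_imp_deriv chain has_vector_derivative_Pair derivative_intros)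
  moreover have "L_dv L (x, y, v, w, z) = ?D (0, 0, 1, 0, 0)"
    unfolding L_dv_def prod.case
    by (intro DERIV_imp_deriv chain has_vector_derivative_Pair derivative_intros)
  moreover have "L_dw L (x, y, v, w, z) = ?D (0, 0, 0, 1, 0)"
    unfolding L_dw_def prod.case
    by (intro DERIV_imp_deriv chain has_vector_derivative_Pair derivative_intros)
  moreover have "L_dz L (x, y, v, w, z) = ?D (0, 0, 0, 0, 1)"
    unfolding L_dz_def prod.case
    by (intro DERIV_imp_deriv chain has_vector_derivative_Pair derivative_intros)
  moreover have "(0, q1, q2, q3, q4) = q1 *\<^sub>R (0, 1, 0, 0, 0) + q2 *\<^sub>R (0, 0, 1, 0, 0)
      + q3 *\<^sub>R (0, 0, 0, 1, 0) + q4 *\<^sub>R ((0, 0, 0, 0, 1) :: real \<times> real \<times> real \<times> real \<times> real)"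
    by simp
  ultimately show ?thesis
    by (simp only: blinfun.add_right blinfun.scaleR_right) simp
qed

lemma C1_partials_l:
  assumes l: "\<forall>p\<in>X \<times> UNIV. (l has_derivative blinfun_apply (l' p)) (at p within X \<times> UNIV)"
    and "x \<in> X"
  shows "l' (x, y, v, w) (0, q1, q2, q3) = l_dy l (x, y, v, w) * q1
     + l_dv l (x, y, v, w) * q2 + l_dw l (x, y, v, w) * q3"
proof -
  let ?D = "l' (x, y, v, w)"
  note chain = C1_chain[OF l \<open>x \<in> X\<close>]
  have "l_dy l (x, y, v, w) = ?D (0, 1, 0, 0)"
    unfolding l_dy_def prod.case
    by (intro DERIV_imp_deriv chain has_vector_derivative_Pair derivative_intros)
  moreover have "l_dv l (x, y, v, w) = ?D (0, 0, 1, 0)"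
    unfolding l_dv_def prod.case
    by (intro DERIV_imp_deriv chain has_vector_derivative_Pair derivative_intros)
  moreover have "l_dw l (x, y, v, w) = ?D (0, 0, 0, 1)"
    unfolding l_dw_def prod.case
    by (intro DERIV_imp_deriv chain has_vector_derivative_Pair derivative_intros)
  moreover have "(0, q1, q2, q3) = q1 *\<^sub>R (0, 1, 0, 0) + q2 *\<^sub>R (0, 0, 1, 0)
      + q3 *\<^sub>R ((0, 0, 0, 1) :: real \<times> real \<times> real \<times> real)"
    by simp
  ultimately show ?thesis
    by (simp only: blinfun.add_right blinfun.scaleR_right) simp
qed

lemma C1_on_imp_continuous_on:
  assumes "C1_on S f"
  shows "continuous_on S f"
proof -
  obtain f' where f': "\<forall>p\<in>S. (f has_derivative blinfun_apply (f' p)) (at p within S)"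
    using assms unfolding C1_on_def by blast
  show ?thesis by (rule has_derivative_continuous_on[OF bspec[OF f']])
qed

locale C1_lagrangian =
  fixes a b \<alpha> \<beta> :: real and L :: fun5 and l :: fun4
  assumes ab: "a < b" and \<alpha>: "0 < \<alpha>" "\<alpha> < 1" and \<beta>: "0 < \<beta>"
    and L_C1: "C1_on ({a..b} \<times> UNIV) L" and l_C1: "C1_on ({a..b} \<times> UNIV) l"
begin

lemma continuous_on_L: "continuous_on ({a..b} \<times> UNIV) L"
  and continuous_on_l: "continuous_on ({a..b} \<times> UNIV) l"
  by (rule C1_on_imp_continuous_on[OF L_C1], rule C1_on_imp_continuous_on[OF l_C1])

lemma continuous_on_braces:
  assumes "u \<in> frac_class a b \<alpha> \<beta>"
  shows "continuous_on {a..b} (braces a \<alpha> \<beta> u)"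
  unfolding braces_def[abs_def] by (intro continuous_intros frac_class_continuous_on[OF assms])

lemma z_int_eq:
  assumes "u \<in> frac_class a b \<alpha> \<beta>" "x \<in> {a..b}"
  shows "z_int a \<alpha> \<beta> l u x = integral {a..x} (\<lambda>t. l (braces a \<alpha> \<beta> u t))"
  unfolding z_int_def
proof (rule set_lebesgue_integral_eq_HK)
  have "continuous_on {a..b} (\<lambda>t. l (braces a \<alpha> \<beta> u t))"
    by (rule continuous_on_compose2[OF continuous_on_l continuous_on_braces[OF assms(1)]])
      (auto simp: braces_def)
  then show "continuous_on {a..x} (\<lambda>t. l (braces a \<alpha> \<beta> u t))"
    by (rule continuous_on_subset) (use assms(2) in auto)
qed

lemma continuous_on_brackets:
  assumes "u \<in> frac_class a b \<alpha> \<beta>"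
  shows "continuous_on {a..b} (brackets a \<alpha> \<beta> l u)"
proof -
  have "continuous_on {a..b} (\<lambda>t. l (braces a \<alpha> \<beta> u t))"
    by (rule continuous_on_compose2[OF continuous_on_l continuous_on_braces[OF assms(1)]])
      (auto simp: braces_def)
  then have "continuous_on {a..b} (\<lambda>x. integral {a..x} (\<lambda>t. l (braces a \<alpha> \<beta> u t)))"
    by (intro indefinite_integral_continuous_1 integrable_continuous_real)
  then have "continuous_on {a..b} (z_int a \<alpha> \<beta> l u)"
    by (rule continuous_on_eq) (simp add: z_int_eq[OF assms])
  then show ?thesis
    unfolding brackets_def[abs_def] by (intro continuous_intros frac_class_continuous_on[OF assms])
qed

lemma continuous_on_L_brackets:
  assumes "u \<in> frac_class a b \<alpha> \<beta>"
  shows "continuous_on {a..b} (\<lambda>x. L (brackets a \<alpha> \<beta> l u x))"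
  by (rule continuous_on_compose2[OF continuous_on_L continuous_on_brackets[OF assms]])
    (auto simp: brackets_def)

lemma J_fun_eq:
  assumes "u \<in> frac_class a b \<alpha> \<beta>" "T \<in> {a..b}"
  shows "J_fun a \<alpha> \<beta> L l u T = integral {a..T} (\<lambda>x. L (brackets a \<alpha> \<beta> l u x))"
  unfolding J_fun_def
  by (rule set_lebesgue_integral_eq_HK, rule continuous_on_subset[OF continuous_on_L_brackets[OF assms(1)]])
    (use assms(2) in auto)

lemma continuous_on_partials:
  assumes "u \<in> frac_class a b \<alpha> \<beta>"
  shows "continuous_on {a..b} (\<lambda>x. L_dy L (brackets a \<alpha> \<beta> l u x))"
    and "continuous_on {a..b} (\<lambda>x. L_dv L (brackets a \<alpha> \<beta> l u x))"
    and "continuous_on {a..b} (\<lambda>x. L_dw L (brackets a \<alpha> \<beta> l u x))"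
    and "continuous_on {a..b} (\<lambda>x. L_dz L (brackets a \<alpha> \<beta> l u x))"
    and "continuous_on {a..b} (\<lambda>x. l_dy l (braces a \<alpha> \<beta> u x))"
    and "continuous_on {a..b} (\<lambda>x. l_dv l (braces a \<alpha> \<beta> u x))"
    and "continuous_on {a..b} (\<lambda>x. l_dw l (braces a \<alpha> \<beta> u x))"
proof -
  obtain L' where L': "continuous_on ({a..b} \<times> UNIV) L'"
    and L: "\<forall>p\<in>{a..b} \<times> UNIV. (L has_derivative blinfun_apply (L' p)) (at p within {a..b} \<times> UNIV)"
    using L_C1 unfolding C1_on_def by blast
  obtain l' where l': "continuous_on ({a..b} \<times> UNIV) l'"
    and l: "\<forall>p\<in>{a..b} \<times> UNIV. (l has_derivative blinfun_apply (l' p)) (at p within {a..b} \<times> UNIV)"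
    using l_C1 unfolding C1_on_def by blast
  have cL: "continuous_on {a..b} (\<lambda>x. L' (brackets a \<alpha> \<beta> l u x) q)" for q
    by (intro continuous_intros continuous_on_compose2[OF L' continuous_on_brackets[OF assms]])
      (auto simp: brackets_def)
  have cl: "continuous_on {a..b} (\<lambda>x. l' (braces a \<alpha> \<beta> u x) q)" for q
    by (intro continuous_intros continuous_on_compose2[OF l' continuous_on_braces[OF assms]])
      (auto simp: braces_def)
  note pL = C1_partials_L[OF L] and pl = C1_partials_l[OF l]
  show "continuous_on {a..b} (\<lambda>x. L_dy L (brackets a \<alpha> \<beta> l u x))"
    by (rule continuous_on_eq[OF cL[of "(0, 1, 0, 0, 0)"]]) (simp add: brackets_def pL)
  show "continuous_on {a..b} (\<lambda>x. L_dv L (brackets a \<alpha> \<beta> l u x))"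
    by (rule continuous_on_eq[OF cL[of "(0, 0, 1, 0, 0)"]]) (simp add: brackets_def pL)
  show "continuous_on {a..b} (\<lambda>x. L_dw L (brackets a \<alpha> \<beta> l u x))"
    by (rule continuous_on_eq[OF cL[of "(0, 0, 0, 1, 0)"]]) (simp add: brackets_def pL)
  show "continuous_on {a..b} (\<lambda>x. L_dz L (brackets a \<alpha> \<beta> l u x))"
    by (rule continuous_on_eq[OF cL[of "(0, 0, 0, 0, 1)"]]) (simp add: brackets_def pL)
  show "continuous_on {a..b} (\<lambda>x. l_dy l (braces a \<alpha> \<beta> u x))"
    by (rule continuous_on_eq[OF cl[of "(0, 1, 0, 0)"]]) (simp add: braces_def pl)
  show "continuous_on {a..b} (\<lambda>x. l_dv l (braces a \<alpha> \<beta> u x))"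
    by (rule continuous_on_eq[OF cl[of "(0, 0, 1, 0)"]]) (simp add: braces_def pl)
  show "continuous_on {a..b} (\<lambda>x. l_dw l (braces a \<alpha> \<beta> u x))"
    by (rule continuous_on_eq[OF cl[of "(0, 0, 0, 1)"]]) (simp add: braces_def pl)
qed

text \<open>As a function of \<open>\<epsilon>\<close>, \<open>J\<close> is a nested parametric
  integral, since \<open>z\<close> itself depends on \<open>\<epsilon>\<close> through
  \<open>l\<close>. \<open>\<zeta>\<close> is the derivative of \<open>z\<close> at parameter 0,
  where \<open>J\<close> has its minimum.\<close>

lemma first_variation:
  assumes y: "y \<in> frac_class a b \<alpha> \<beta>" and T: "T \<in> {a..b}"
    and \<eta>: "\<And>x. (\<eta> has_real_derivative \<eta>' x) (at x)" and \<eta>': "continuous_on UNIV \<eta>'"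
    and min: "\<And>\<epsilon>. J_fun a \<alpha> \<beta> L l y T \<le> J_fun a \<alpha> \<beta> L l (\<lambda>x. y x + \<epsilon> * \<eta> x) T"
  defines "P \<equiv> brackets a \<alpha> \<beta> l y" and "Q \<equiv> braces a \<alpha> \<beta> y"
    and "\<eta>v \<equiv> caputo_left a \<alpha> \<eta>" and "\<eta>w \<equiv> rl_int_left a \<beta> \<eta>"
  defines "\<zeta> \<equiv> \<lambda>x. integral {a..x} (\<lambda>t. l_dy l (Q t) * \<eta> t + l_dv l (Q t) * \<eta>v t + l_dw l (Q t) * \<eta>w t)"
  shows "integral {a..T} (\<lambda>x. L_dy L (P x) * \<eta> x + L_dv L (P x) * \<eta>v x + L_dw L (P x) * \<eta>w x
      + L_dz L (P x) * \<zeta> x) = 0"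
proof -
  obtain L' where L': "continuous_on ({a..b} \<times> UNIV) L'"
    and L: "\<forall>p\<in>{a..b} \<times> UNIV. (L has_derivative blinfun_apply (L' p)) (at p within {a..b} \<times> UNIV)"
    using L_C1 unfolding C1_on_def by blast
  obtain l' where l': "continuous_on ({a..b} \<times> UNIV) l'"
    and l: "\<forall>p\<in>{a..b} \<times> UNIV. (l has_derivative blinfun_apply (l' p)) (at p within {a..b} \<times> UNIV)"
    using l_C1 unfolding C1_on_def by blast
  define u where "u \<epsilon> = (\<lambda>x. y x + \<epsilon> * \<eta> x)" for \<epsilon>
  note pert = frac_class_perturb[OF y \<alpha>(2) \<beta> \<eta> \<eta>', folded u_def]
  define v w where "v = caputo_left a \<alpha> y" and "w = rl_int_left a \<beta> y"
  have \<eta>F: "\<eta> \<in> frac_class a b \<alpha> \<beta>" by (rule frac_class_C1(1)[OF \<alpha>(2) \<beta> \<eta> \<eta>'])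
  note cy = frac_class_continuous_on[OF y, folded v_def w_def]
    and c\<eta> = frac_class_continuous_on[OF \<eta>F, folded \<eta>v_def \<eta>w_def]
  define c where "c \<epsilon> t = (y t + \<epsilon> * \<eta> t, v t + \<epsilon> * \<eta>v t, w t + \<epsilon> * \<eta>w t)" for \<epsilon> t
  define c' where "c' = (\<lambda>(\<epsilon>::real) t. (\<eta> t, \<eta>v t, \<eta>w t))"
  have par: "continuous_on (UNIV \<times> {a..b}) (\<lambda>q :: real \<times> real. h (snd q))"
    if "continuous_on {a..b} h" for h :: "real \<Rightarrow> real"
    by (rule continuous_on_compose2[OF that]) (auto intro!: continuous_intros)
  have dc: "((\<lambda>\<epsilon>. c \<epsilon> t) has_vector_derivative c' \<epsilon> t) (at \<epsilon>)" for \<epsilon> t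
    unfolding c_def c'_def
    by (intro has_vector_derivative_Pair) (auto simp flip: has_real_derivative_iff_has_vector_derivative
      intro!: derivative_eq_intros)
  have cc: "continuous_on (UNIV \<times> {a..b}) (\<lambda>(\<epsilon>, t). c \<epsilon> t)"
    "continuous_on (UNIV \<times> {a..b}) (\<lambda>(\<epsilon>, t). c' \<epsilon> t)"
    unfolding c_def c'_def case_prod_unfold by (intro continuous_intros par cy c\<eta>)+
  note Z = C1_parametric_integral[OF l l' dc cc]
  define z where "z \<epsilon> x = integral {a..x} (\<lambda>t. l (t, c \<epsilon> t))" for \<epsilon> x
  define z' where "z' \<epsilon> x = integral {a..x} (\<lambda>t. l' (t, c \<epsilon> t) (0, c' \<epsilon> t))" for \<epsilon> x
  note Z = Z[folded z_def z'_def]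
  \<comment> \<open>The first three components are affine in \<open>\<epsilon>\<close>; the fourth
    is not, and its velocity \<open>z'\<close> comes from the parametric integral of
    \<open>l\<close>.\<close>
  define d where "d \<epsilon> x = (y x + \<epsilon> * \<eta> x, v x + \<epsilon> * \<eta>v x, w x + \<epsilon> * \<eta>w x, z \<epsilon> x)" for \<epsilon> x
  define d' where "d' \<epsilon> x = (\<eta> x, \<eta>v x, \<eta>w x, z' \<epsilon> x)" for \<epsilon> x
  have dd: "((\<lambda>\<epsilon>. d \<epsilon> x) has_vector_derivative d' \<epsilon> x) (at \<epsilon>)" if "x \<in> {a..b}" for \<epsilon> x
    unfolding d_def d'_def using Z(1)[OF that]
    by (intro has_vector_derivative_Pair) (auto simp flip: has_real_derivative_iff_has_vector_derivative
      intro!: derivative_eq_intros)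
  have cd: "continuous_on (UNIV \<times> {a..b}) (\<lambda>(\<epsilon>, t). d \<epsilon> t)"
    "continuous_on (UNIV \<times> {a..b}) (\<lambda>(\<epsilon>, t). d' \<epsilon> t)"
    unfolding d_def d'_def case_prod_unfold
    by (intro continuous_intros par cy c\<eta> Z(2,3)[unfolded case_prod_unfold])+
  have u: "u \<epsilon> t = y t + \<epsilon> * \<eta> t" for \<epsilon> t by (simp add: u_def)
  have bra: "braces a \<alpha> \<beta> (u \<epsilon>) t = (t, c \<epsilon> t)" if "t \<in> {a..b}" for \<epsilon> t
    using pert(2,3)[OF that] by (simp add: braces_def c_def v_def w_def \<eta>v_def \<eta>w_def u)
  have br: "brackets a \<alpha> \<beta> l (u \<epsilon>) x = (x, d \<epsilon> x)" if x: "x \<in> {a..b}" for \<epsilon> x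
  proof -
    have "z_int a \<alpha> \<beta> l (u \<epsilon>) x = z \<epsilon> x"
      unfolding z_int_eq[OF pert(1) x] z_def
      by (rule integral_cong) (use x bra in auto)
    then show ?thesis
      using pert(2,3)[OF x] by (simp add: brackets_def d_def v_def w_def \<eta>v_def \<eta>w_def u)
  qed
  have u0: "u 0 = y" by (simp add: u_def)
  have J: "J_fun a \<alpha> \<beta> L l (u \<epsilon>) T = integral {a..T} (\<lambda>x. L (x, d \<epsilon> x))" for \<epsilon>
    unfolding J_fun_eq[OF pert(1) T] using br T by (intro integral_cong) auto
  have "((\<lambda>\<epsilon>. J_fun a \<alpha> \<beta> L l (u \<epsilon>) T) has_real_derivative
      integral {a..T} (\<lambda>x. L' (x, d 0 x) (0, d' 0 x))) (at 0)"
    unfolding J by (rule C1_parametric_integral(1)[OF L L' dd cd T])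
  then have "integral {a..T} (\<lambda>x. L' (x, d 0 x) (0, d' 0 x)) = 0"
    by (rule DERIV_local_min[OF _ zero_less_one]) (use min u0 in \<open>simp add: u_def\<close>)
  moreover have "z' 0 x = \<zeta> x" if "x \<in> {a..b}" for x
    unfolding z'_def \<zeta>_def
  proof (rule integral_cong)
    fix t assume "t \<in> {a..x}"
    then have "t \<in> {a..b}" using that by auto
    then show "l' (t, c 0 t) (0, c' 0 t) = l_dy l (Q t) * \<eta> t + l_dv l (Q t) * \<eta>v t + l_dw l (Q t) * \<eta>w t"
      using C1_partials_l[OF l] by (simp add: c_def c'_def Q_def braces_def v_def w_def)
  qed
  moreover have "P x = (x, d 0 x)" if "x \<in> {a..b}" for x
    using br[OF that, of 0] u0 by (simp add: P_def)
  ultimately show ?thesis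
    using T C1_partials_L[OF L]
    by (subst (asm) integral_cong[of _ _ "\<lambda>x. L_dy L (P x) * \<eta> x + L_dv L (P x) * \<eta>v x + L_dw L (P x) * \<eta>w x
      + L_dz L (P x) * \<zeta> x"]) (auto simp: d_def d'_def)
qed

end

section \<open>Integration by parts and the weak equation\<close>

lemma rl_int_by_parts:
  assumes f: "continuous_on {a..T} f" and h: "continuous_on {a..T} h" and "0 < \<gamma>"
  shows "integral {a..T} (\<lambda>x. f x * rl_int_left a \<gamma> h x)
    = integral {a..T} (\<lambda>x. rl_int_right T \<gamma> f x * h x)"
proof -
  let ?l = "\<lambda>x. LINT t:{a..x}|lebesgue. (x - t) powr (\<gamma> - 1) * h t"
  let ?r = "\<lambda>t. LINT x:{t..T}|lebesgue. (x - t) powr (\<gamma> - 1) * f x"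
  have "continuous_on {a..T} (\<lambda>x. f x * ?l x)" "continuous_on {a..T} (\<lambda>t. ?r t * h t)"
    by (intro continuous_on_mult f h continuous_on_left_conv continuous_on_right_conv \<open>0 < \<gamma>\<close>)+
  from this[THEN set_lebesgue_integral_eq_HK]
  have "integral {a..T} (\<lambda>x. f x * ?l x) = integral {a..T} (\<lambda>t. ?r t * h t)"
    using integral_left_conv_swap[OF f h \<open>0 < \<gamma>\<close>] by simp
  then have "integral {a..T} (\<lambda>x. 1 / Gamma \<gamma> * (f x * ?l x)) = integral {a..T} (\<lambda>t. 1 / Gamma \<gamma> * (?r t * h t))"
    by (simp only: integral_mult_right)
  then show ?thesis by (simp add: rl_int_left_def rl_int_right_def)
qed

text \<open>The factors \<open>integral {x..T} f\<close> and \<open>integral {a..x} g\<close> vanish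
  at opposite ends, so integrating the derivative of their product leaves no boundary term. This
  takes the integral off the variation of \<open>z\<close> and creates the factor
  \<open>M\<close>.\<close>

lemma integral_upper_lower_swap:
  fixes f g :: "real \<Rightarrow> real"
  assumes "a \<le> T" and f: "continuous_on {a..T} f" and g: "continuous_on {a..T} g"
  shows "integral {a..T} (\<lambda>x. f x * integral {a..x} g) = integral {a..T} (\<lambda>x. integral {x..T} f * g x)"
    and "continuous_on {a..T} (\<lambda>x. integral {x..T} f)"
proof -
  let ?F = "\<lambda>x. integral {x..T} f" and ?G = "\<lambda>x. integral {a..x} g"
  have F: "?F x = integral {a..T} f - integral {a..x} f" if "x \<in> {a..T}" for x
    using Henstock_Kurzweil_Integration.integral_combine[of a x T f] that
      integrable_continuous_real[OF f] by simp
  have dG: "(?G has_real_derivative g x) (at x within {a..T})" if "x \<in> {a..T}" for x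
    by (rule integral_has_real_derivative[OF g that])
  have dF: "(?F has_real_derivative - f x) (at x within {a..T})" if "x \<in> {a..T}" for x
  proof -
    have "((\<lambda>x. integral {a..T} f - integral {a..x} f) has_real_derivative 0 - f x) (at x within {a..T})"
      by (rule DERIV_diff[OF DERIV_const]) (rule integral_has_real_derivative[OF f that])
    from has_field_derivative_transform_within[OF this zero_less_one that F[symmetric]]
    show ?thesis by simp
  qed
  show cF: "continuous_on {a..T} ?F" by (rule DERIV_continuous_on[OF dF])
  have cG: "continuous_on {a..T} ?G" by (rule DERIV_continuous_on[OF dG])
  have "((\<lambda>x. ?F x * ?G x) has_vector_derivative ?F x * g x + - f x * ?G x) (at x within {a..T})"
    if "x \<in> {a..T}" for x
    using DERIV_mult'[OF dF[OF that] dG[OF that]]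
    by (simp add: has_real_derivative_iff_has_vector_derivative)
  then have "((\<lambda>x. ?F x * g x + - f x * ?G x) has_integral ?F T * ?G T - ?F a * ?G a) {a..T}"
    by (rule fundamental_theorem_of_calculus[OF \<open>a \<le> T\<close>])
  then have "integral {a..T} (\<lambda>x. ?F x * g x + - f x * ?G x) = 0"
    by (simp add: integral_unique)
  moreover have "integral {a..T} (\<lambda>x. ?F x * g x + - f x * ?G x)
      = integral {a..T} (\<lambda>x. ?F x * g x) - integral {a..T} (\<lambda>x. f x * ?G x)"
    by (subst integral_diff[symmetric])
      (auto intro!: integrable_continuous_real continuous_on_mult f g cF cG)
  ultimately show "integral {a..T} (\<lambda>x. f x * ?G x) = integral {a..T} (\<lambda>x. ?F x * g x)" by simp
qed

lemma continuous_on_integral_lower: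
  fixes f :: "real \<Rightarrow> real"
  assumes f: "continuous_on {a..T} f"
  shows "continuous_on {a..T} (\<lambda>x. LINT t:{x..T}|lebesgue. f t)"
proof (cases "a \<le> T")
  case True
  have "integral {x..T} f = (LINT t:{x..T}|lebesgue. f t)" if "x \<in> {a..T}" for x
    by (rule set_lebesgue_integral_eq_HK[symmetric], rule continuous_on_subset[OF f]) (use that in auto)
  then show ?thesis
    by (rule continuous_on_eq[OF integral_upper_lower_swap(2)[OF True f f]])
qed simp

context C1_lagrangian
begin

text \<open>\<open>A\<close>, \<open>B\<close> and \<open>C\<close> are the total coefficients of
  \<open>\<eta>\<close>, its Caputo derivative and its fractional integral, once \<open>M\<close>
  has distributed the contribution of \<open>z\<close>. The right integral of \<open>C\<close> joins
  \<open>A\<close> as coefficient of \<open>\<eta>\<close>.\<close>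

lemma weak_Euler_Lagrange:
  assumes y: "y \<in> frac_class a b \<alpha> \<beta>" and T: "T \<in> {a..b}" "a < T"
    and min: "\<And>u. u \<in> frac_class a b \<alpha> \<beta> \<Longrightarrow> J_fun a \<alpha> \<beta> L l y T \<le> J_fun a \<alpha> \<beta> L l u T"
  defines "P \<equiv> brackets a \<alpha> \<beta> l y" and "Q \<equiv> braces a \<alpha> \<beta> y"
  defines "M \<equiv> \<lambda>x. LINT t:{x..T}|lebesgue. L_dz L (P t)"
  defines "A \<equiv> \<lambda>x. L_dy L (P x) + M x * l_dy l (Q x)"
    and "B \<equiv> \<lambda>x. L_dv L (P x) + M x * l_dv l (Q x)"
    and "C \<equiv> \<lambda>x. L_dw L (P x) + M x * l_dw l (Q x)"
  defines "\<psi> \<equiv> \<lambda>x. A x + rl_int_right T \<beta> C x"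
  shows "x \<in> {a..T} \<Longrightarrow> rl_int_right T (1 - \<alpha>) B x = integral {a..x} \<psi>"
    and "continuous_on {a..T} \<psi>"
proof -
  note cont = continuous_on_partials[OF y, THEN continuous_on_subset, of "{a..T}", folded P_def Q_def]
  have sub: "{a..T} \<subseteq> {a..b}" using T by auto
  note cont = cont[OF sub]
  have M: "M x = integral {x..T} (\<lambda>t. L_dz L (P t))" if "x \<in> {a..T}" for x
    unfolding M_def using that by (intro set_lebesgue_integral_eq_HK continuous_on_subset[OF cont(4)]) auto
  have cM: "continuous_on {a..T} M"
    unfolding M_def using cont(4) by (rule continuous_on_integral_lower)
  have cA: "continuous_on {a..T} A" and cB: "continuous_on {a..T} B" and cC: "continuous_on {a..T} C"
    unfolding A_def B_def C_def by (intro continuous_intros cM cont)+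
  have cr: "continuous_on {a..T} (rl_int_right T \<gamma> f)" if "continuous_on {a..T} f" "0 < \<gamma>" for f \<gamma>
    unfolding rl_int_right_def
    by (intro continuous_on_mult continuous_on_const continuous_on_right_conv that)
  show c\<psi>: "continuous_on {a..T} \<psi>"
    unfolding \<psi>_def by (intro continuous_intros cA cr[OF cC] \<beta>)
  have cB': "continuous_on {a..T} (rl_int_right T (1 - \<alpha>) B)" using \<alpha> by (intro cr cB) simp
  have split3: "integral {a..T} (\<lambda>x. p x + q x + r x)
      = integral {a..T} p + integral {a..T} q + integral {a..T} r"
    if "continuous_on {a..T} p" "continuous_on {a..T} q" "continuous_on {a..T} r" for p q r :: "real \<Rightarrow> real"
    using that by (simp add: integral_add integrable_continuous_real continuous_on_add)
  show "rl_int_right T (1 - \<alpha>) B x = integral {a..x} \<psi>" if "x \<in> {a..T}"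
  proof (rule du_Bois_Reymond[OF T(2) c\<psi> cB' _ that])
    fix \<eta> \<eta>' :: "real \<Rightarrow> real"
    assume \<eta>: "\<And>x. (\<eta> has_real_derivative \<eta>' x) (at x)" and \<eta>': "continuous_on UNIV \<eta>'"
    define v w where "v = caputo_left a \<alpha> \<eta>" and "w = rl_int_left a \<beta> \<eta>"
    have \<eta>F: "\<eta> \<in> frac_class a b \<alpha> \<beta>" by (rule frac_class_C1(1)[OF \<alpha>(2) \<beta> \<eta> \<eta>'])
    have v: "v = rl_int_left a (1 - \<alpha>) \<eta>'"
      unfolding v_def by (rule frac_class_C1(2)[OF \<alpha>(2) \<beta> \<eta> \<eta>'])
    note c\<eta> = frac_class_continuous_on[OF \<eta>F, THEN continuous_on_subset, OF sub, folded v_def w_def]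
    have c\<eta>': "continuous_on {a..T} \<eta>'" by (rule continuous_on_subset[OF \<eta>' subset_UNIV])
    define g where "g t = l_dy l (Q t) * \<eta> t + l_dv l (Q t) * v t + l_dw l (Q t) * w t" for t
    define f where "f x = L_dy L (P x) * \<eta> x + L_dv L (P x) * v x + L_dw L (P x) * w x" for x
    have cg: "continuous_on {a..T} g" and cf: "continuous_on {a..T} f"
      unfolding g_def f_def by (intro continuous_intros cont c\<eta>)+
    have cG: "continuous_on {a..T} (\<lambda>x. integral {a..x} g)"
      by (intro indefinite_integral_continuous_1 integrable_continuous_real cg)
    have "0 = integral {a..T} (\<lambda>x. f x + L_dz L (P x) * integral {a..x} g)"
      using first_variation[OF y T(1) \<eta> \<eta>' min] frac_class_perturb(1)[OF y \<alpha>(2) \<beta> \<eta> \<eta>']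
      unfolding P_def Q_def v_def w_def f_def g_def by simp
    also have "\<dots> = integral {a..T} f + integral {a..T} (\<lambda>x. L_dz L (P x) * integral {a..x} g)"
      by (intro integral_add integrable_continuous_real continuous_on_mult cf cont cG)
    also have "integral {a..T} (\<lambda>x. L_dz L (P x) * integral {a..x} g)
        = integral {a..T} (\<lambda>x. integral {x..T} (\<lambda>t. L_dz L (P t)) * g x)"
      using T by (intro integral_upper_lower_swap(1) cont cg) simp
    also have "\<dots> = integral {a..T} (\<lambda>x. M x * g x)"
      by (rule integral_cong) (simp only: M)
    also have "integral {a..T} f + integral {a..T} (\<lambda>x. M x * g x) = integral {a..T} (\<lambda>x. f x + M x * g x)"
      by (intro integral_add[symmetric] integrable_continuous_real continuous_on_mult cf cM cg)
    also have "\<dots> = integral {a..T} (\<lambda>x. A x * \<eta> x + B x * v x + C x * w x)"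
      by (simp add: f_def g_def A_def B_def C_def algebra_simps)
    also have "\<dots> = integral {a..T} (\<lambda>x. A x * \<eta> x) + integral {a..T} (\<lambda>x. B x * v x)
        + integral {a..T} (\<lambda>x. C x * w x)"
      by (intro split3 continuous_on_mult cA cB cC c\<eta>)
    \<comment> \<open>\<open>v\<close> is the left integral of order \<open>1 - \<alpha>\<close> of
      \<open>\<eta>'\<close>, so the transposed integral of \<open>B\<close> ends up multiplying
      \<open>\<eta>'\<close>, as du Bois-Reymond requires.\<close>
    also have "integral {a..T} (\<lambda>x. B x * v x) = integral {a..T} (\<lambda>x. rl_int_right T (1 - \<alpha>) B x * \<eta>' x)"
      unfolding v using \<alpha> by (intro rl_int_by_parts cB c\<eta>') simp
    also have "integral {a..T} (\<lambda>x. C x * w x) = integral {a..T} (\<lambda>x. rl_int_right T \<beta> C x * \<eta> x)"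
      unfolding w_def by (intro rl_int_by_parts cC c\<eta> \<beta>)
    also have "integral {a..T} (\<lambda>x. A x * \<eta> x) + integral {a..T} (\<lambda>x. rl_int_right T (1 - \<alpha>) B x * \<eta>' x)
        + integral {a..T} (\<lambda>x. rl_int_right T \<beta> C x * \<eta> x)
        = integral {a..T} (\<lambda>x. A x * \<eta> x + rl_int_right T (1 - \<alpha>) B x * \<eta>' x + rl_int_right T \<beta> C x * \<eta> x)"
      by (intro split3[symmetric] continuous_on_mult cA cB' cr[OF cC \<beta>] c\<eta> c\<eta>')
    also have "\<dots> = integral {a..T} (\<lambda>x. \<psi> x * \<eta> x + rl_int_right T (1 - \<alpha>) B x * \<eta>' x)"
      by (simp add: \<psi>_def algebra_simps)
    finally show "integral {a..T} (\<lambda>x. \<psi> x * \<eta> x + rl_int_right T (1 - \<alpha>) B x * \<eta>' x) = 0" by simp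
  qed
qed

end

section \<open>The pointwise equation and transversality\<close>

lemma rl_int_right_add:
  assumes "continuous_on {a..T} f" "continuous_on {a..T} g" "0 < \<gamma>" "x \<in> {a..T}"
  shows "rl_int_right T \<gamma> (\<lambda>x. f x + g x) x = rl_int_right T \<gamma> f x + rl_int_right T \<gamma> g x"
proof -
  interpret f: clipped_function a T f by standard (rule assms)
  interpret g: clipped_function a T g by standard (rule assms)
  show ?thesis
    using f.right_conv_eq(2)[OF assms(4,3)] g.right_conv_eq(2)[OF assms(4,3)]
    by (simp add: rl_int_right_def algebra_simps add_divide_distrib)
qed

text \<open>Continuity makes the integrals additive, but not each of them differentiable, hence the
  two existence hypotheses. Derivatives within \<open>{a..T}\<close> are unique because
  \<open>a < T\<close>.\<close>

lemma rl_deriv_right_add: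
  assumes "a < T" and f: "continuous_on {a..T} f" and g: "continuous_on {a..T} g" and "\<alpha> < 1"
    and x: "x \<in> {a..T}"
    and ex: "rl_deriv_right_exists a T \<alpha> f x" "rl_deriv_right_exists a T \<alpha> g x"
  shows "rl_deriv_right a T \<alpha> (\<lambda>x. f x + g x) x = rl_deriv_right a T \<alpha> f x + rl_deriv_right a T \<alpha> g x"
proof -
  interpret f: clipped_function a T f by standard (rule f)
  interpret g: clipped_function a T g by standard (rule g)
  define K where "K h s = (LINT t:{s..T}|lebesgue. (t - s) powr (- \<alpha>) * h t)" for h :: "real \<Rightarrow> real" and s
  have K: "K f s + K g s = K (\<lambda>x. f x + g x) s" if "s \<in> {a..T}" for s
    using f.right_conv_eq(2)[OF that, of "1 - \<alpha>"] g.right_conv_eq(2)[OF that, of "1 - \<alpha>"] \<open>\<alpha> < 1\<close>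
    by (simp add: K_def distrib_left)
  have "((\<lambda>s. K f s + K g s) has_vector_derivative
      vector_derivative (K f) (at x within {a..T}) + vector_derivative (K g) (at x within {a..T})) (at x within {a..T})"
    using ex unfolding rl_deriv_right_exists_def K_def[symmetric]
    by (intro has_vector_derivative_add) (simp_all add: vector_derivative_works)
  from has_vector_derivative_transform_within[OF this zero_less_one x K]
  have "vector_derivative (K (\<lambda>x. f x + g x)) (at x within {a..T})
      = vector_derivative (K f) (at x within {a..T}) + vector_derivative (K g) (at x within {a..T})"
    using vector_derivative_within_cbox[OF \<open>a < T\<close>] x by simp
  then show ?thesis
    unfolding rl_deriv_right_def K_def[symmetric] by (simp add: distrib_left)
qed

context C1_lagrangian
begin

text \<open>The weak form exhibits the right integral of \<open>B\<close> as a primitive of a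
  continuous function, which makes it differentiable, endpoints included. At \<open>a\<close> the
  primitive is an integral over a single point.\<close>

lemma Euler_Lagrange:
  assumes y: "y \<in> frac_class a b \<alpha> \<beta>" and T: "T \<in> {a..b}" "a < T"
    and min: "\<And>u. u \<in> frac_class a b \<alpha> \<beta> \<Longrightarrow> J_fun a \<alpha> \<beta> L l y T \<le> J_fun a \<alpha> \<beta> L l u T"
  defines "P \<equiv> brackets a \<alpha> \<beta> l y" and "Q \<equiv> braces a \<alpha> \<beta> y"
  defines "M \<equiv> \<lambda>x. LINT t:{x..T}|lebesgue. L_dz L (P t)"
  defines "A \<equiv> \<lambda>x. L_dy L (P x) + M x * l_dy l (Q x)"
    and "B \<equiv> \<lambda>x. L_dv L (P x) + M x * l_dv l (Q x)"
    and "C \<equiv> \<lambda>x. L_dw L (P x) + M x * l_dw l (Q x)"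
  shows "x \<in> {a..T} \<Longrightarrow> rl_deriv_right_exists a T \<alpha> B x"
    and "x \<in> {a..T} \<Longrightarrow> A x + rl_int_right T \<beta> C x + rl_deriv_right a T \<alpha> B x = 0"
    and "rl_int_right T (1 - \<alpha>) B a = 0"
proof -
  define \<psi> where "\<psi> x = A x + rl_int_right T \<beta> C x" for x
  note weak = weak_Euler_Lagrange[OF y T min]
  have w: "rl_int_right T (1 - \<alpha>) B x = integral {a..x} \<psi>" if "x \<in> {a..T}" for x
    using weak(1)[OF _ that] unfolding P_def Q_def M_def A_def B_def C_def \<psi>_def[abs_def] .
  have c\<psi>: "continuous_on {a..T} \<psi>"
    using weak(2) unfolding P_def Q_def M_def A_def B_def C_def \<psi>_def[abs_def] .
  show "rl_int_right T (1 - \<alpha>) B a = 0" using w[of a] T by simp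
  define K where "K s = (LINT t:{s..T}|lebesgue. (t - s) powr (- \<alpha>) * B t)" for s
  have G: "Gamma (1 - \<alpha>) > 0" using \<alpha> by (intro Gamma_real_pos) simp
  \<comment> \<open>\<open>K\<close> is the integral inside \<open>rl_deriv_right\<close>, without
    the Gamma factor. Its derivative is therefore \<open>Gamma (1 - \<alpha>) * \<psi> x\<close>,
    and the sign in the definition yields \<open>- \<psi> x\<close>.\<close>
  have K: "Gamma (1 - \<alpha>) * integral {a..s} \<psi> = K s" if "s \<in> {a..T}" for s
    using w[OF that] G by (simp add: rl_int_right_def K_def field_simps)
  have d: "(K has_vector_derivative Gamma (1 - \<alpha>) * \<psi> x) (at x within {a..T})" if "x \<in> {a..T}" for x
  proof (rule has_vector_derivative_transform_within[OF _ zero_less_one that K])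
    show "((\<lambda>s. Gamma (1 - \<alpha>) * integral {a..s} \<psi>) has_vector_derivative Gamma (1 - \<alpha>) * \<psi> x)
        (at x within {a..T})"
      by (intro has_vector_derivative_mult_right integral_has_vector_derivative[OF c\<psi> that])
  qed
  show "rl_deriv_right_exists a T \<alpha> B x" if "x \<in> {a..T}"
    unfolding rl_deriv_right_exists_def K_def[symmetric] by (rule differentiableI_vector[OF d[OF that]])
  show "A x + rl_int_right T \<beta> C x + rl_deriv_right a T \<alpha> B x = 0" if x: "x \<in> {a..T}"
  proof -
    have "vector_derivative K (at x within {a..T}) = Gamma (1 - \<alpha>) * \<psi> x"
      using vector_derivative_within_cbox[OF T(2), of x K] d[OF x] x by simp
    then show ?thesis
      using G unfolding rl_deriv_right_def K_def[symmetric] by (simp add: \<psi>_def)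
  qed
qed

text \<open>As a function of the terminal point, \<open>J\<close> is a primitive of its integrand.
  An interior \<open>T\<close> can be compared with points on both sides; at an end of
  \<open>{a..b}\<close> minimality would give only an inequality.\<close>

lemma transversality_T:
  assumes y: "y \<in> frac_class a b \<alpha> \<beta>" and T: "a < T" "T < b"
    and min: "\<And>S. S \<in> {a..b} \<Longrightarrow> J_fun a \<alpha> \<beta> L l y T \<le> J_fun a \<alpha> \<beta> L l y S"
  shows "L (brackets a \<alpha> \<beta> l y T) = 0"
proof -
  let ?f = "\<lambda>x. L (brackets a \<alpha> \<beta> l y x)"
  have "((\<lambda>S. integral {a..S} ?f) has_real_derivative ?f T) (at T within {a..b})"
    using T by (intro integral_has_real_derivative continuous_on_L_brackets y) auto
  moreover have "at T within {a..b} = at T"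
    using T by (intro at_within_interior) simp
  ultimately have d: "((\<lambda>S. integral {a..S} ?f) has_real_derivative ?f T) (at T)" by simp
  show ?thesis
  proof (rule DERIV_local_min[OF d])
    show "0 < min (T - a) (b - T)" using T by simp
    show "\<forall>S. \<bar>T - S\<bar> < min (T - a) (b - T) \<longrightarrow> integral {a..T} ?f \<le> integral {a..S} ?f"
    proof (intro allI impI)
      fix S assume "\<bar>T - S\<bar> < min (T - a) (b - T)"
      then have "S \<in> {a..b}" by auto
      then show "integral {a..T} ?f \<le> integral {a..S} ?f"
        using min[of S] J_fun_eq[OF y, of S] J_fun_eq[OF y, of T] T by simp
    qed
  qed
qed

end

text \<open>The equation holds with the Riemann-Liouville derivative of the sum, whose existence is
  part of the conclusion; with two separate derivatives it holds wherever both exist.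
  \<open>L (P T) = 0\<close> is claimed for interior \<open>T\<close> only: for \<open>L\<close>
  constantly -1 the minimum is attained at \<open>T = b\<close>. For \<open>T = a\<close> the
  derivative within \<open>{a..T}\<close> is meaningless, while the boundary condition at
  \<open>a\<close> remains.\<close>

theorem theorem9:
  fixes a b \<alpha> \<beta> T :: real
    and L :: "real \<times> real \<times> real \<times> real \<times> real \<Rightarrow> real"
    and l :: "real \<times> real \<times> real \<times> real \<Rightarrow> real"
    and y :: "real \<Rightarrow> real"
  assumes "a < b" and "0 < \<alpha>" and "\<alpha> < 1" and "0 < \<beta>"
    and "C1_on ({a..b} \<times> UNIV) L" and "C1_on ({a..b} \<times> UNIV) l"
    and "y \<in> frac_class a b \<alpha> \<beta>" and "T \<in> {a..b}"
    and "\<forall>u \<in> frac_class a b \<alpha> \<beta>. \<forall>S \<in> {a..b}. J_fun a \<alpha> \<beta> L l y T \<le> J_fun a \<alpha> \<beta> L l u S"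
  shows
    "let P = brackets a \<alpha> \<beta> l y;
         Q = braces a \<alpha> \<beta> y;
         M = (\<lambda>x. LINT t:{x..T}|lebesgue. L_dz L (P t));
         I = rl_int_right T;
         D = rl_deriv_right a T \<alpha>;
         D_exists = rl_deriv_right_exists a T \<alpha>
     in
       (a < T \<longrightarrow> (\<forall>x\<in>{a..T}.
          (D_exists (\<lambda>x. L_dv L (P x)) x \<and> D_exists (\<lambda>x. M x * l_dv l (Q x)) x \<longrightarrow>
             L_dy L (P x) + D (\<lambda>x. L_dv L (P x)) x + I \<beta> (\<lambda>x. L_dw L (P x)) x
             + M x * l_dy l (Q x)
             + D (\<lambda>x. M x * l_dv l (Q x)) x + I \<beta> (\<lambda>x. M x * l_dw l (Q x)) x = 0) \<and>
          D_exists (\<lambda>x. L_dv L (P x) + M x * l_dv l (Q x)) x \<and>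
          L_dy L (P x) + I \<beta> (\<lambda>x. L_dw L (P x)) x
             + M x * l_dy l (Q x)
             + D (\<lambda>x. L_dv L (P x) + M x * l_dv l (Q x)) x
             + I \<beta> (\<lambda>x. M x * l_dw l (Q x)) x = 0)) \<and>
       I (1 - \<alpha>) (\<lambda>x. L_dv L (P x) + M x * l_dv l (Q x)) a = 0 \<and>
       (a < T \<and> T < b \<longrightarrow> L (P T) = 0)"
proof -
  interpret C1_lagrangian a b \<alpha> \<beta> L l by unfold_locales (fact assms)+
  define P Q where "P = brackets a \<alpha> \<beta> l y" and "Q = braces a \<alpha> \<beta> y"
  define M where "M x = (LINT t:{x..T}|lebesgue. L_dz L (P t))" for x
  note y = \<open>y \<in> frac_class a b \<alpha> \<beta>\<close> and T = \<open>T \<in> {a..b}\<close>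
  have min: "J_fun a \<alpha> \<beta> L l y T \<le> J_fun a \<alpha> \<beta> L l u S"
    if "u \<in> frac_class a b \<alpha> \<beta>" "S \<in> {a..b}" for u S
    using assms(9) that by blast
  let ?B = "\<lambda>x. L_dv L (P x) + M x * l_dv l (Q x)"
  let ?D = "rl_deriv_right a T \<alpha>"
  have EL: "rl_deriv_right_exists a T \<alpha> ?B x \<and>
      L_dy L (P x) + rl_int_right T \<beta> (\<lambda>x. L_dw L (P x)) x + M x * l_dy l (Q x)
        + ?D ?B x + rl_int_right T \<beta> (\<lambda>x. M x * l_dw l (Q x)) x = 0 \<and>
      (rl_deriv_right_exists a T \<alpha> (\<lambda>x. L_dv L (P x)) x \<and>
        rl_deriv_right_exists a T \<alpha> (\<lambda>x. M x * l_dv l (Q x)) x \<longrightarrow>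
        ?D ?B x = ?D (\<lambda>x. L_dv L (P x)) x + ?D (\<lambda>x. M x * l_dv l (Q x)) x)"
    if "a < T" and x: "x \<in> {a..T}" for x
  proof -
    have "{a..T} \<subseteq> {a..b}" using T by auto
    note cont = continuous_on_partials[OF y, THEN continuous_on_subset, OF this, folded P_def Q_def]
    have M: "continuous_on {a..T} M"
      unfolding M_def[abs_def] using cont(4) by (rule continuous_on_integral_lower)
    note EL = Euler_Lagrange[OF y T \<open>a < T\<close> min[OF _ T], folded P_def Q_def, folded M_def]
    have "rl_int_right T \<beta> (\<lambda>x. L_dw L (P x) + M x * l_dw l (Q x)) x
        = rl_int_right T \<beta> (\<lambda>x. L_dw L (P x)) x + rl_int_right T \<beta> (\<lambda>x. M x * l_dw l (Q x)) x"
      by (intro rl_int_right_add[where a = a] continuous_on_mult cont M \<beta> x)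
    moreover have "?D ?B x = ?D (\<lambda>x. L_dv L (P x)) x + ?D (\<lambda>x. M x * l_dv l (Q x)) x"
      if "rl_deriv_right_exists a T \<alpha> (\<lambda>x. L_dv L (P x)) x"
        "rl_deriv_right_exists a T \<alpha> (\<lambda>x. M x * l_dv l (Q x)) x"
      by (intro rl_deriv_right_add[OF \<open>a < T\<close>] continuous_on_mult cont M \<alpha> x that)
    ultimately show ?thesis using EL(1,2)[OF _ x] by simp
  qed
  have at_a: "rl_int_right T (1 - \<alpha>) ?B a = 0"
  proof (cases "a < T")
    case True
    show ?thesis
      using Euler_Lagrange(3)[OF y T True min[OF _ T], folded P_def Q_def, folded M_def] .
  next
    case False
    \<comment> \<open>The integral over one point vanishes; the weight there is a power of 0, which
      \<open>powr\<close> sets to 0.\<close>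
    then have "T = a" using T by simp
    moreover have "(LINT t:{a..a}|lebesgue. (t - a) powr ((1 - \<alpha>) - 1) * ?B t)
        = (LINT t:{a..a}|lebesgue. 0)"
      by (rule set_lebesgue_integral_cong) auto
    ultimately show ?thesis by (simp add: rl_int_right_def)
  qed
  have at_T: "L (P T) = 0" if "a < T" "T < b"
    unfolding P_def using y that min[OF y] by (rule transversality_T)
  show ?thesis
    unfolding Let_def P_def[symmetric] Q_def[symmetric]
    unfolding M_def[symmetric]
    using EL at_a at_T by (intro conjI impI ballI) (fastforce+)
qed

end
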